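(* Let $K\subset\mathbb{R}^n$ be a convex body of constant width $2r$, and write $h_K=r+h_{\mathrm{odd}}$ with $h_{\mathrm{odd}}$ odd. For $p=0,\ldots,\lfloor n/2\rfloor$ put $$\mathcal Q_{2p}(h_{\mathrm{odd}})=V\left(h_{\mathrm{odd}}^{[2p]},1^{[n-2p]}\right),\qquad \mathcal Q_0(h_{\mathrm{odd}})=\kappa_n.$$ For $j=0,\ldots,n$, $$W_j(K)=\sum_{p=0}^{\lfloor(n-j)/2\rfloor}\binom{n-j}{2p}r^{\,n-j-2p}\mathcal Q_{2p}(h_{\mathrm{odd}}).$$ For $n\geqslant3$, volume and surface area satisfy $$\mathrm{Vol}_n(K)=\frac{r}{n-2}S(K)-\frac{2\kappa_n}{n-2}r^n+\frac{2}{n-2}\sum_{p=2}^{\lfloor n/2\rfloor}(p-1)\binom{n}{2p}r^{\,n-2p}\mathcal Q_{2p}(h_{\mathrm{odd}}).$$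
   Context: A convex body in $\mathbb{R}^n$ is a compact convex set with non-empty interior; $h_K(u)=\max_{x\in K}\langle x,u\rangle$, $u\in\mathbb{S}^{n-1}$, is its support function. $K$ has constant width $2r$ ($r>0$) if $h_K(u)+h_K(-u)=2r$ for all $u$. $B=B^n$ is the unit ball, $\kappa_n=\mathrm{Vol}_n(B^n)$. $V$ is the mixed volume, normalized by $V(K,\ldots,K)=\mathrm{Vol}_n(K)$; $[m]$ denotes repetition $m$ times. $W_j(K)=V(K^{[n-j]},B^{[j]})$, and $S(K)=nW_1(K)=\mathcal H^{n-1}(\partial K)$ is the surface area. Identifying bodies with their support functions, mixed volume is extended multilinearly to linear combinations (formal differences) of support functions on $\mathbb{S}^{n-1}$; the function $1$ is the support function of $B^n$. *)

theory Defs
  imports "HOL-Analysis.Analysis" "HOL-Library.Set_Algebras" "HOL-Library.Multiset"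
begin

definition convex_body :: "(real ^ 'n::finite) set \<Rightarrow> bool" where
  "convex_body K \<longleftrightarrow> compact K \<and> convex K \<and> interior K \<noteq> {}"

text \<open>The supremum is attained when \<open>K\<close> is compact and nonempty. Only its values on the unit
  sphere are used below.\<close>

definition support_function :: "(real ^ 'n::finite) set \<Rightarrow> real ^ 'n \<Rightarrow> real" where
  "support_function K u = (SUP x\<in>K. x \<bullet> u)"

definition constant_width :: "(real ^ 'n::finite) set \<Rightarrow> real \<Rightarrow> bool" where
  "constant_width K w \<longleftrightarrow>
     (\<forall>u\<in>sphere 0 1. support_function K u + support_function K (- u) = w)"

text \<open>Mixed volume of bodies \<open>K\<^sub>0, \<dots>, K\<^sub>n\<^sub>-\<^sub>1\<close> with \<open>n = CARD('n)\<close>, as a coefficient in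
  Minkowski's polynomial expansion
  \<open>Vol (\<Sum>\<^sub>i c\<^sub>i K\<^sub>i) = \<Sum> c\<^bsub>i(1)\<^esub> \<cdots> c\<^bsub>i(n)\<^esub> V(K\<^bsub>i(1)\<^esub>, \<dots>, K\<^bsub>i(n)\<^esub>)\<close> for \<open>c \<ge> 0\<close>, the sum on the right
  running over all index words of length \<open>n\<close>. The coefficients are symmetric in the indices, which
  is encoded by letting them depend only on the multiset of the word; \<open>M (mset [0..<n])\<close> is the
  coefficient at the indices \<open>0, \<dots>, n-1\<close>, and it is unique. The sum on the left is the
  Minkowski sum of sets. Meaningful only for \<open>length Ks = CARD('n)\<close>.\<close>

definition mixed_volume :: "(real ^ 'n::finite) set list \<Rightarrow> real" where
  "mixed_volume Ks = (THE v. \<exists>M :: nat multiset \<Rightarrow> real.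
     (\<forall>c :: nat \<Rightarrow> real. (\<forall>i. 0 \<le> c i) \<longrightarrow>
        measure lebesgue (\<Sum>i<CARD('n). (\<lambda>x. c i *\<^sub>R x) ` (Ks ! i)) =
        (\<Sum>w | set w \<subseteq> {..<CARD('n)} \<and> length w = CARD('n).
            prod_list (map c w) * M (mset w)))
     \<and> v = M (mset [0..<CARD('n)]))"

text \<open>Multilinear extension to functions \<open>f\<^sub>i = h\<^bsub>K(i)\<^esub> - h\<^bsub>L(i)\<^esub>\<close> on the sphere. Every linear
  combination of support functions of convex bodies is such a difference. The definite description
  is the assertion that the expanded value does not depend on the chosen representations.\<close>

definition mixed_volume_fun :: "(real ^ 'n::finite \<Rightarrow> real) list \<Rightarrow> real" where
  "mixed_volume_fun fs = (THE v. \<exists>Ks Ls. length Ks = CARD('n) \<and> length Ls = CARD('n) \<and>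
     (\<forall>i<CARD('n). convex_body (Ks ! i) \<and> convex_body (Ls ! i) \<and>
        (\<forall>u\<in>sphere 0 1. (fs ! i) u = support_function (Ks ! i) u - support_function (Ls ! i) u)) \<and>
     v = (\<Sum>I\<in>Pow {..<CARD('n)}. (-1) ^ card I *
            mixed_volume (map (\<lambda>i. if i \<in> I then Ls ! i else Ks ! i) [0..<CARD('n)])))"

definition quermassintegral :: "nat \<Rightarrow> (real ^ 'n::finite) set \<Rightarrow> real" where
  "quermassintegral j K =
     mixed_volume (replicate (CARD('n) - j) K @ replicate j (cball 0 1))"

text \<open>For convex bodies this is the \<open>(n-1)\<close>-dimensional Hausdorff measure of the boundary.\<close>

definition surface_area :: "(real ^ 'n::finite) set \<Rightarrow> real" where
  "surface_area K = real CARD('n) * quermassintegral 1 K"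

text \<open>\<open>mixed_Q m f = V(f\<^sup>[\<^sup>m\<^sup>], 1\<^sup>[\<^sup>n\<^sup>-\<^sup>m\<^sup>])\<close>\<close>

definition mixed_Q :: "nat \<Rightarrow> (real ^ 'n::finite \<Rightarrow> real) \<Rightarrow> real" where
  "mixed_Q m f = mixed_volume_fun (replicate m f @ replicate (CARD('n) - m) (\<lambda>_. 1))"

end

theory Submission
  imports Defs
begin

text \<open>The proof rests on Minkowski's theorem that \<open>Vol (\<Sum>\<^sub>i c\<^sub>i K\<^sub>i)\<close> is a polynomial in \<open>c \<ge> 0\<close>. For a
  convex body \<open>K\<close>, let \<open>f(x)\<close> be the logarithm of the integral of \<open>exp (x \<bullet> P t)\<close> over a large box,
  where \<open>P\<close> is the nearest point map onto \<open>K\<close>. Then \<open>f\<close> is smooth and strictly convex and its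
  gradient maps the whole space bijectively onto a set between the interior of \<open>K\<close> and \<open>K\<close>. The same
  holds for \<open>\<Sum>\<^sub>i c\<^sub>i f\<^sub>i\<close> and \<open>\<Sum>\<^sub>i c\<^sub>i K\<^sub>i\<close>, so the volume is the integral of \<open>det (\<Sum>\<^sub>i c\<^sub>i D\<^sup>2f\<^sub>i)\<close>, a polynomial
  in \<open>c\<close>. Mixed volumes are thus integrals of mixed discriminants, hence multilinear. Expanding
  \<open>h\<^sub>o\<^sub>d\<^sub>d = h\<^sub>K - r\<close> multilinearly expresses the \<open>Q\<^sub>m\<close> by the \<open>W\<^sub>j(K)\<close>, binomial inversion recovers the
  \<open>W\<^sub>j(K)\<close>, and replacing \<open>K\<close> by \<open>-K\<close> shows \<open>Q\<^sub>m = 0\<close> for odd \<open>m\<close>.\<close>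

subsection \<open>Volume of the range of an injective differentiable map\<close>

text \<open>The mixed volume is a definite description, so the expansion must be proved before any
  value can be computed. The obstacle is that a support function need not be smooth and, being
  linear along rays, is never strictly convex. The log-integral is an exact substitute, not an
  approximation: only the image of the gradient matters, and growth at infinity determines it up to
  boundary points. This growth condition is additive, so one potential per body serves all Minkowski
  combinations. Integrating over \<open>P t\<close> on a larger box gives every point of K, boundary
  included, a full ball of mass nearby, which makes the growth bound uniform in the point.

  The functional \<open>mvol\<close> is defined by polarization, not as a coefficient. Symmetry and
  reflection invariance are then immediate, and only additivity and homogeneity in one slot need
  integrals. Zero coefficients collapse a body to \<open>{0}\<close>, and the function 1 in
  \<open>mixed_Q\<close> must first be written as a difference of two bodies;
  \<open>body_or_point\<close> brings both situations under the same multilinear calculus.\<close>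

text \<open>The change of variables theorem of the library requires a well-ordered index type, so it is
  transferred along a well-ordered copy of a finite type.\<close>

datatype 'a wo = Wo (unWo: 'a)

lemma bij_Wo: "bij Wo"
  by (metis bijI' wo.exhaust wo.inject)

lemma bij_unWo: "bij unWo"
  by (metis bijI' wo.exhaust_sel wo.sel)

instance wo :: (finite) finite
proof
  have "(UNIV :: 'a wo set) = range Wo"
    by (rule bij_is_surj[OF bij_Wo, symmetric])
  then show "finite (UNIV :: 'a wo set)"
    by (metis finite finite_imageI)
qed

instantiation wo :: (finite) wellorder
begin

definition less_eq_wo :: "'a wo \<Rightarrow> 'a wo \<Rightarrow> bool" where
  "x \<le> y \<longleftrightarrow> to_nat (unWo x) \<le> to_nat (unWo y)"

definition less_wo :: "'a wo \<Rightarrow> 'a wo \<Rightarrow> bool" where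
  "x < y \<longleftrightarrow> to_nat (unWo x) < to_nat (unWo y)"

instance
proof
  fix P :: "'a wo \<Rightarrow> bool" and a
  assume step: "\<And>x. (\<And>y. y < x \<Longrightarrow> P y) \<Longrightarrow> P x"
  show "P a"
    by (induction a rule: measure_induct_rule[of "\<lambda>x. to_nat (unWo x)"])
      (use step less_wo_def in blast)
qed (auto simp: less_eq_wo_def less_wo_def wo.expand)

end

definition to_wo :: "real^'n \<Rightarrow> real^('n wo)" where
  "to_wo x = (\<chi> i. x $ unWo i)"

definition of_wo :: "real^('n wo) \<Rightarrow> real^'n" where
  "of_wo x = (\<chi> i. x $ Wo i)"

lemma of_wo_to_wo [simp]: "of_wo (to_wo x) = x"
  and to_wo_of_wo [simp]: "to_wo (of_wo y) = y"
  by (simp_all add: of_wo_def to_wo_def)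

lemma linear_to_wo: "linear (to_wo :: real^'n::finite \<Rightarrow> _)"
  and linear_of_wo: "linear (of_wo :: _ \<Rightarrow> real^'n::finite)"
  by (auto intro!: linearI simp: of_wo_def to_wo_def vec_eq_iff)

lemma prod_Basis_cart:
  fixes f :: "real^'n::finite \<Rightarrow> real"
  shows "prod f Basis = (\<Prod>i\<in>UNIV. f (axis i 1))"
proof -
  have eq: "(Basis :: (real^'n) set) = (\<lambda>i. axis i 1) ` UNIV"
    by (auto simp: Basis_vec_def)
  have inj: "inj (\<lambda>i::'n. axis i (1::real) :: real^'n)"
    by (auto simp: inj_def axis_eq_axis)
  show ?thesis
    unfolding eq by (subst prod.reindex[OF inj]) simp
qed

lemma distr_lborel_to_wo:
  "distr lborel lborel (to_wo :: real^'n::finite \<Rightarrow> _) = lborel"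
proof (rule lborel_eqI[symmetric])
  have [measurable]: "(to_wo :: real^'n \<Rightarrow> _) \<in> borel_measurable borel"
    by (intro borel_measurable_continuous_onI linear_continuous_on)
      (simp add: linear_conv_bounded_linear[symmetric] linear_to_wo)
  fix l u :: "real^('n wo)"
  assume le: "\<And>b. b \<in> Basis \<Longrightarrow> l \<bullet> b \<le> u \<bullet> b"
  have le': "l $ i \<le> u $ i" for i
    using le[of "axis i 1"] by (simp add: axis_in_Basis_iff inner_axis)
  have vim: "to_wo -` box l u = box (of_wo l :: real^'n) (of_wo u)"
    by (auto simp: mem_box_cart to_wo_def of_wo_def) (metis wo.collapse wo.sel)+
  have le2: "\<And>b. b \<in> Basis \<Longrightarrow> (of_wo l :: real^'n) \<bullet> b \<le> of_wo u \<bullet> b"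
    using le' by (auto simp: Basis_vec_def inner_axis of_wo_def)
  have "emeasure (distr lborel lborel to_wo) (box l u) = emeasure lborel (box (of_wo l :: real^'n) (of_wo u))"
    by (subst emeasure_distr) (auto simp: vim)
  also have "\<dots> = ennreal (\<Prod>b\<in>Basis. (of_wo u - of_wo l :: real^'n) \<bullet> b)"
    using le2 by (subst emeasure_lborel_box) auto
  also have "(\<Prod>b\<in>Basis. (of_wo u - of_wo l :: real^'n) \<bullet> b) = (\<Prod>i\<in>(UNIV::'n set). u $ Wo i - l $ Wo i)"
    by (simp add: prod_Basis_cart inner_axis of_wo_def)
  also have "\<dots> = (\<Prod>i\<in>UNIV. u $ i - l $ i)"
    using prod.reindex_bij_betw[OF bij_Wo, of "\<lambda>i. u $ i - l $ i"] by simp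
  also have "\<dots> = (\<Prod>b\<in>Basis. (u - l) \<bullet> b)"
    by (simp add: prod_Basis_cart inner_axis)
  finally show "emeasure (distr lborel lborel to_wo) (box l u) = ennreal (\<Prod>b\<in>Basis. (u - l) \<bullet> b)" .
qed simp

lemma distr_lebesgue_to_wo:
  "distr lebesgue lebesgue (to_wo :: real^'n::finite \<Rightarrow> _) = lebesgue"
  and measurable_to_wo: "(to_wo :: real^'n::finite \<Rightarrow> _) \<in> lebesgue \<rightarrow>\<^sub>M lebesgue"
proof -
  have m: "(to_wo :: real^'n \<Rightarrow> _) \<in> lborel \<rightarrow>\<^sub>M lborel"
    using borel_measurable_continuous_onI[OF linear_continuous_on[of "to_wo :: real^'n \<Rightarrow> _" UNIV]]
    by (simp add: linear_conv_bounded_linear[symmetric] linear_to_wo)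
  have d: "distr lebesgue lborel (to_wo :: real^'n \<Rightarrow> _) = lborel"
    by (simp add: distr_completion[OF m] distr_lborel_to_wo)
  show "distr lebesgue lebesgue (to_wo :: real^'n \<Rightarrow> _) = lebesgue"
    using completion.completion_distr_eq[OF measurable_completion[OF m]] d by simp
  show "(to_wo :: real^'n::finite \<Rightarrow> _) \<in> lebesgue \<rightarrow>\<^sub>M lebesgue"
    using completion.measurable_completion2[OF measurable_completion[OF m]] d by simp
qed

text \<open>Conjugating permutations with the bijection \<open>Wo\<close> preserves their signs, so
  the two Leibniz sums agree term by term.\<close>

lemma det_reindex_wo:
  fixes A :: "real^'n::finite^'n"
  shows "det (\<chi> i j. A $ unWo i $ unWo j) = det A"
proof -
  have 1: "bij_betw (map_permutation UNIV Wo) {p. p permutes (UNIV::'n set)} {p. p permutes UNIV}"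
  proof (rule bij_betw_byWitness[of _ "map_permutation UNIV unWo"])
    show "\<forall>p\<in>{p. p permutes (UNIV::'n set)}. map_permutation UNIV unWo (map_permutation UNIV Wo p) = p"
      by (auto intro!: map_permutation_compose_inv simp: bij_Wo)
    show "\<forall>p\<in>{p. p permutes UNIV}. map_permutation UNIV Wo (map_permutation (UNIV :: 'n wo set) unWo p) = p"
      by (auto intro!: map_permutation_compose_inv simp: bij_unWo)
  qed (auto intro!: map_permutation_permutes simp: bij_Wo bij_unWo)
  have "det (\<chi> i j. A $ unWo i $ unWo j) =
     (\<Sum>p\<in>{p. p permutes UNIV}. of_int (sign p) * (\<Prod>i\<in>UNIV. A $ unWo i $ unWo (p i)))"
    by (simp add: det_def)
  also have "\<dots> = (\<Sum>p\<in>{p. p permutes (UNIV :: 'n set)}. of_int (sign (map_permutation UNIV Wo p)) *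
       (\<Prod>i\<in>UNIV. A $ unWo i $ unWo (map_permutation UNIV Wo p i)))"
    using sum.reindex_bij_betw[OF 1, of "\<lambda>p. of_int (sign p) * (\<Prod>i\<in>UNIV. A $ unWo i $ unWo (p i))"] by simp
  also have "\<dots> = (\<Sum>p\<in>{p. p permutes (UNIV :: 'n set)}. of_int (sign p) * (\<Prod>i\<in>UNIV. A $ i $ p i))"
  proof (rule sum.cong[OF refl])
    fix p assume p: "p \<in> {p. p permutes (UNIV :: 'n set)}"
    have inj: "inj_on Wo (UNIV :: 'n set)" by (rule bij_is_inj[OF bij_Wo])
    have "(\<Prod>i\<in>UNIV. A $ unWo i $ unWo (map_permutation UNIV Wo p i)) = (\<Prod>i\<in>UNIV. A $ i $ p i)"
      using prod.reindex_bij_betw[OF bij_Wo, of "\<lambda>i. A $ unWo i $ unWo (map_permutation UNIV Wo p i)"] inj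
      by (simp add: map_permutation_apply)
    moreover have "sign (map_permutation UNIV Wo p) = sign p"
      using p inj by (auto intro!: sign_map_permutation)
    ultimately show "real_of_int (sign (map_permutation UNIV Wo p)) *
       (\<Prod>i\<in>UNIV. A $ unWo i $ unWo (map_permutation UNIV Wo p i)) =
      of_int (sign p) * (\<Prod>i\<in>UNIV. A $ i $ p i)" by simp
  qed
  also have "\<dots> = det A" by (simp add: det_def)
  finally show ?thesis .
qed

text \<open>Change of variables on the copied index type, pulled back along the measure preserving
  \<open>to_wo\<close>. Finite measure of the image yields integrability of the determinant, and its
  sign removes the absolute value.\<close>

proposition measure_range_eq_integral_det:
  fixes g :: "real^'n::finite \<Rightarrow> real^'n" and H :: "real^'n \<Rightarrow> real^'n^'n"
  assumes der: "\<And>x. (g has_derivative (\<lambda>h. H x *v h)) (at x)"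
    and inj: "inj g" and nonneg: "\<And>x. det (H x) \<ge> 0" and meas: "range g \<in> lmeasurable"
  shows "has_bochner_integral lebesgue (\<lambda>x. det (H x)) (measure lebesgue (range g))"
proof -
  define g' :: "real^('n wo) \<Rightarrow> real^('n wo)" where "g' = to_wo \<circ> g \<circ> of_wo"
  define H' :: "real^('n wo) \<Rightarrow> real^('n wo)^('n wo)" where
    "H' y = (\<chi> i j. H (of_wo y) $ unWo i $ unWo j)" for y
  have det': "det (H' y) = det (H (of_wo y))" for y
    by (simp add: H'_def det_reindex_wo)
  have mv: "to_wo (H x *v of_wo h) = H' (to_wo x) *v h" for x h
    using sum.reindex_bij_betw[OF bij_Wo, of "\<lambda>j. H x $ unWo i $ unWo j * h $ j" for i]
    by (simp add: vec_eq_iff to_wo_def of_wo_def H'_def matrix_vector_mult_def)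
  have der': "(g' has_derivative (\<lambda>h. H' y *v h)) (at y)" for y
  proof -
    have 1: "(of_wo has_derivative of_wo) (at y)" and 2: "(to_wo has_derivative to_wo) (at (g (of_wo y)))"
      using linear_of_wo linear_to_wo linear_imp_has_derivative by blast+
    have "(g' has_derivative to_wo \<circ> (\<lambda>h. H (of_wo y) *v h) \<circ> of_wo) (at y)"
      unfolding g'_def o_assoc[symmetric]
      by (intro diff_chain_at 1) (auto intro!: diff_chain_at der 2 simp: o_def)
    then show ?thesis by (simp add: o_def mv)
  qed
  have inj': "inj_on g' UNIV"
    using inj by (auto simp: g'_def inj_def) (metis of_wo_to_wo to_wo_of_wo)
  have rg: "range g = to_wo -` range g'"
    by (auto simp: g'_def image_iff) (metis of_wo_to_wo)+
  have sets': "range g' \<in> sets lebesgue"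
    using der' by (intro differentiable_image_in_sets_lebesgue) (auto simp: differentiable_on_def differentiable_def intro: has_derivative_at_withinI)
  have em: "emeasure lebesgue (range g') = emeasure lebesgue (range g)"
    using emeasure_distr[OF measurable_to_wo sets'] by (simp add: distr_lebesgue_to_wo rg)
  have "range g' \<in> lmeasurable"
    using meas sets' em by (auto simp: fmeasurable_def)
  moreover have "measure lebesgue (range g') = measure lebesgue (range g)"
    using em by (simp add: measure_def)
  ultimately have "((\<lambda>y. \<bar>det (matrix (\<lambda>h. H' y *v h))\<bar>) has_integral measure lebesgue (range g)) UNIV"
    using has_measure_differentiable_image[of UNIV g' "\<lambda>y h. H' y *v h" "measure lebesgue (range g)", OF _ der' inj'] by simp
  then have hi: "((\<lambda>y. det (H' y)) has_integral measure lebesgue (range g)) UNIV"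
    by (simp add: det' nonneg)
  \<comment> \<open>For a nonnegative function, gauge integrability gives absolute integrability,
    hence a Lebesgue integral with the same value.\<close>
  then have "(\<lambda>y. det (H' y)) absolutely_integrable_on UNIV"
    by (intro nonnegative_absolutely_integrable_1) (auto simp: det' nonneg)
  then have "integrable lebesgue (\<lambda>y. det (H' y))" "(LINT y|lebesgue. det (H' y)) = measure lebesgue (range g)"
    using hi set_lebesgue_integral_eq_integral(2)[of UNIV "\<lambda>y. det (H' y)"]
    by (auto simp: set_integrable_def set_lebesgue_integral_def)
  then have hb: "has_bochner_integral lebesgue (\<lambda>y. det (H' y)) (measure lebesgue (range g))"
    by (simp add: has_bochner_integral_iff)
  have meas_det: "(\<lambda>y. det (H' y)) \<in> borel_measurable lebesgue"
    using hb by (auto simp: has_bochner_integral_iff)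
  from hb have "has_bochner_integral (distr lebesgue lebesgue (to_wo :: real^'n \<Rightarrow> _)) (\<lambda>y. det (H' y)) (measure lebesgue (range g))"
    by (simp add: distr_lebesgue_to_wo)
  then show ?thesis
    using integrable_distr_eq[OF measurable_to_wo meas_det] integral_distr[OF measurable_to_wo meas_det]
    by (simp add: has_bochner_integral_iff det')
qed

subsection \<open>Gradient maps onto convex bodies\<close>

text \<open>The segment from \<open>A\<close> to the identity consists of matrices with positive
  quadratic form, hence invertible ones, so the determinant cannot change sign along it. This covers
  non-symmetric \<open>A\<close>; \<open>potential\<close> does not record symmetry of
  \<open>H\<close>.\<close>

lemma det_pos_of_pos_def:
  fixes A :: "real^'n::finite^'n"
  assumes pos: "\<And>h. h \<noteq> 0 \<Longrightarrow> h \<bullet> (A *v h) > 0"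
  shows "det A > 0"
proof (rule ccontr)
  assume "\<not> det A > 0"
  define B where "B t = (1 - t) *\<^sub>R A + t *\<^sub>R mat 1" for t :: real
  have nz: "det (B t) \<noteq> 0" if t: "0 \<le> t" "t \<le> 1" for t
  proof -
    have "x = 0" if x: "B t *v x = 0" for x
    proof (rule ccontr)
      assume "x \<noteq> 0"
      have "x \<bullet> (B t *v x) = (1 - t) * (x \<bullet> (A *v x)) + t * (x \<bullet> x)"
        by (simp add: B_def matrix_vector_mult_add_rdistrib scaleR_matrix_vector_assoc[symmetric] inner_add_right)
      moreover have "x \<bullet> (A *v x) > 0" "x \<bullet> x > 0" using pos \<open>x \<noteq> 0\<close> by auto
      moreover have "0 < (1 - t) * (x \<bullet> (A *v x)) + t * (x \<bullet> x)"
      proof (cases "t = 1")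
        case False
        then show ?thesis using t calculation by (intro add_pos_nonneg) auto
      qed (use calculation in auto)
      ultimately show False using x by simp
    qed
    then have "invertible (B t)"
      by (simp add: invertible_left_inverse matrix_left_invertible_ker)
    then show ?thesis by (simp add: invertible_det_nz)
  qed
  have "continuous_on {0..1} (\<lambda>t. det (B t))"
    unfolding det_def B_def by (auto intro!: continuous_intros)
  moreover have "det (B 0) \<le> 0" "0 \<le> det (B 1)"
    using \<open>\<not> det A > 0\<close> by (auto simp: B_def)
  ultimately obtain t where "0 \<le> t" "t \<le> 1" "det (B t) = 0"
    using IVT'[of "\<lambda>t. det (B t)" 0 0 1] by auto
  with nz show False by blast
qed

text \<open>A strictly convex \<open>f\<close> with gradient \<open>m\<close> and Hessian \<open>H\<close> that grows like the support function
  of \<open>K\<close> has the property that \<open>m\<close> maps the whole space onto \<open>K\<close> up to boundary points.\<close>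

definition potential ::
  "(real^'n::finite) set \<Rightarrow> (real^'n \<Rightarrow> real) \<Rightarrow> (real^'n \<Rightarrow> real^'n) \<Rightarrow> (real^'n \<Rightarrow> real^'n^'n) \<Rightarrow> bool" where
  "potential K f m H \<longleftrightarrow>
     (\<forall>x. (f has_derivative (\<lambda>h. m x \<bullet> h)) (at x)) \<and>
     (\<forall>x. (m has_derivative (\<lambda>h. H x *v h)) (at x)) \<and>
     (\<forall>x h. h \<noteq> 0 \<longrightarrow> h \<bullet> (H x *v h) > 0) \<and>
     range m \<subseteq> K \<and>
     (\<forall>e>0. \<exists>C. \<forall>x. \<forall>y\<in>K. x \<bullet> y - e * norm x - C \<le> f x)"

lemma potentialD:
  assumes "potential K f m H"
  shows "\<And>x. (f has_derivative (\<lambda>h. m x \<bullet> h)) (at x)"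
    and "\<And>x. (m has_derivative (\<lambda>h. H x *v h)) (at x)"
    and "\<And>x h. h \<noteq> 0 \<Longrightarrow> h \<bullet> (H x *v h) > 0"
    and "range m \<subseteq> K"
    and "\<And>e. e > 0 \<Longrightarrow> \<exists>C. \<forall>x. \<forall>y\<in>K. x \<bullet> y - e * norm x - C \<le> f x"
  using assms unfolding potential_def by blast+

text \<open>The growth clause speaks of points \<open>y\<close> of the set and allows an arbitrary
  slack \<open>e\<close> so that it adds up: a point of \<open>K + L\<close> splits as
  \<open>a + b\<close>, each summand taking half the slack. Surjectivity of the gradients would not
  add up; \<open>potential_interior_subset\<close> recovers it from growth.\<close>

lemma potential_add:
  assumes K: "potential K f m H" and L: "potential L f' m' H'"
  shows "potential (K + L) (\<lambda>x. f x + f' x) (\<lambda>x. m x + m' x) (\<lambda>x. H x + H' x)"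
  unfolding potential_def
proof (intro conjI allI impI)
  fix x
  show "((\<lambda>x. f x + f' x) has_derivative (\<lambda>h. (m x + m' x) \<bullet> h)) (at x)"
    unfolding inner_add_left by (intro has_derivative_add potentialD(1)[OF K] potentialD(1)[OF L])
  show "((\<lambda>x. m x + m' x) has_derivative (\<lambda>h. (H x + H' x) *v h)) (at x)"
    unfolding matrix_vector_mult_add_rdistrib
    by (intro has_derivative_add potentialD(2)[OF K] potentialD(2)[OF L])
  fix h :: "real^'a" assume "h \<noteq> 0"
  then show "0 < h \<bullet> ((H x + H' x) *v h)"
    using potentialD(3)[OF K, of h x] potentialD(3)[OF L, of h x]
    by (simp add: matrix_vector_mult_add_rdistrib inner_add_right)
next
  show "range (\<lambda>x. m x + m' x) \<subseteq> K + L"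
    using potentialD(4)[OF K] potentialD(4)[OF L] by auto
next
  fix e :: real assume "e > 0"
  then obtain C C' where C: "\<And>x y. y \<in> K \<Longrightarrow> x \<bullet> y - e/2 * norm x - C \<le> f x"
    and C': "\<And>x y. y \<in> L \<Longrightarrow> x \<bullet> y - e/2 * norm x - C' \<le> f' x"
    using potentialD(5)[OF K, of "e/2"] potentialD(5)[OF L, of "e/2"] half_gt_zero by metis
  have "x \<bullet> y - e * norm x - (C + C') \<le> f x + f' x" if y: "y \<in> K + L" for x y
  proof -
    obtain a b where "y = a + b" "a \<in> K" "b \<in> L" using y by (auto elim: set_plus_elim)
    then show ?thesis using C[of a x] C'[of b x] by (simp add: inner_add_right)
  qed
  then show "\<exists>C. \<forall>x. \<forall>y\<in>K + L. x \<bullet> y - e * norm x - C \<le> f x + f' x" by blast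
qed

lemma potential_scaleR:
  assumes K: "potential K f m H" and c: "c > 0"
  shows "potential ((\<lambda>x. c *\<^sub>R x) ` K) (\<lambda>x. c * f x) (\<lambda>x. c *\<^sub>R m x) (\<lambda>x. c *\<^sub>R H x)"
  unfolding potential_def
proof (intro conjI allI impI)
  fix x
  show "((\<lambda>x. c * f x) has_derivative (\<lambda>h. (c *\<^sub>R m x) \<bullet> h)) (at x)"
    unfolding inner_scaleR_left by (intro has_derivative_mult_right potentialD(1)[OF K])
  show "((\<lambda>x. c *\<^sub>R m x) has_derivative (\<lambda>h. (c *\<^sub>R H x) *v h)) (at x)"
    unfolding scaleR_matrix_vector_assoc[symmetric]
    by (intro has_derivative_scaleR_right potentialD(2)[OF K])
  fix h :: "real^'a" assume "h \<noteq> 0"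
  then show "0 < h \<bullet> ((c *\<^sub>R H x) *v h)"
    using potentialD(3)[OF K, of h x] c
    by (simp add: scaleR_matrix_vector_assoc[symmetric])
next
  show "range (\<lambda>x. c *\<^sub>R m x) \<subseteq> (\<lambda>x. c *\<^sub>R x) ` K"
    using potentialD(4)[OF K] by auto
next
  fix e :: real assume "e > 0"
  then obtain C where C: "\<And>x y. y \<in> K \<Longrightarrow> x \<bullet> y - e/c * norm x - C \<le> f x"
    using potentialD(5)[OF K, of "e/c"] c by auto
  have "x \<bullet> (c *\<^sub>R y) - e * norm x - c * C \<le> c * f x" if y: "y \<in> K" for x y
    using mult_left_mono[OF C[OF y, of x], of c] c by (simp add: algebra_simps)
  then show "\<exists>C. \<forall>x. \<forall>y\<in>(\<lambda>x. c *\<^sub>R x) ` K. x \<bullet> y - e * norm x - C \<le> c * f x" by blast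
qed

text \<open>Positive definiteness makes the gradient strictly monotone: its component along
  \<open>y - x\<close> increases on the segment from \<open>x\<close> to \<open>y\<close>.\<close>

lemma potential_gradient_inj:
  assumes K: "potential K f m H"
  shows "inj m"
proof (rule injI, rule ccontr)
  fix x y assume eq: "m x = m y" and ne: "x \<noteq> y"
  define g where "g t = m (x + t *\<^sub>R (y - x)) \<bullet> (y - x)" for t :: real
  have der: "(g has_real_derivative (H (x + t *\<^sub>R (y - x)) *v (y - x)) \<bullet> (y - x)) (at t)" for t
  proof -
    have "((\<lambda>t. x + t *\<^sub>R (y - x)) has_derivative (\<lambda>h. h *\<^sub>R (y - x))) (at t)"
      by (auto intro!: derivative_eq_intros)
    then have "((\<lambda>t. m (x + t *\<^sub>R (y - x))) has_derivative
        (\<lambda>h. H (x + t *\<^sub>R (y - x)) *v (h *\<^sub>R (y - x)))) (at t)"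
      by (rule has_derivative_compose[OF _ potentialD(2)[OF K]])
    then have "(g has_derivative (\<lambda>h. (H (x + t *\<^sub>R (y - x)) *v (h *\<^sub>R (y - x))) \<bullet> (y - x))) (at t)"
      unfolding g_def by (rule has_derivative_inner_left)
    then show ?thesis
      by (simp add: has_field_derivative_def matrix_vector_mult_scaleR mult.commute[of _ "_ \<bullet> _"] mult_commute_abs)
  qed
  have "g 0 < g 1"
  proof (rule DERIV_pos_imp_increasing[of 0 1 g])
    fix t :: real assume "0 \<le> t" "t \<le> 1"
    show "\<exists>D. (g has_real_derivative D) (at t) \<and> 0 < D"
      using der[of t] potentialD(3)[OF K, of "y - x" "x + t *\<^sub>R (y - x)"] ne
      by (auto simp: inner_commute)
  qed simp
  then show False using eq by (simp add: g_def)
qed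

text \<open>For interior \<open>y\<close> the function \<open>f x - x \<bullet> y\<close> is
  coercive, so it attains a minimum, and there \<open>m x = y\<close>. Coercivity: moving
  \<open>y\<close> by \<open>e\<close> in the direction of \<open>x\<close> stays in
  \<open>K\<close> and gains \<open>e * norm x\<close>, of which the slack uses up half.\<close>

lemma potential_interior_subset:
  assumes K: "potential K f m H"
  shows "interior K \<subseteq> range m"
proof
  fix y assume "y \<in> interior K"
  then obtain e where e: "e > 0" "cball y e \<subseteq> K"
    by (auto simp: mem_interior_cball)
  obtain C where C: "\<And>x z. z \<in> K \<Longrightarrow> x \<bullet> z - e/2 * norm x - C \<le> f x"
    using potentialD(5)[OF K, of "e/2"] e(1) by auto
  have grow: "e/2 * norm x - C \<le> f x - x \<bullet> y" for x
  proof (cases "x = 0")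
    case True
    then show ?thesis using C[of y x] e by (auto simp: subset_eq)
  next
    case False
    have "y + (e / norm x) *\<^sub>R x \<in> K" using e False by (auto simp: subset_eq dist_norm)
    from C[OF this, of x] have "x \<bullet> y + e / norm x * (x \<bullet> x) - e/2 * norm x - C \<le> f x"
      by (simp add: inner_add_right)
    moreover have "e / norm x * (x \<bullet> x) = e * norm x"
      using False by (simp add: power2_norm_eq_inner[symmetric] power2_eq_square)
    ultimately show ?thesis by simp
  qed
  define g where "g x = f x - x \<bullet> y" for x
  \<comment> \<open>Outside this radius the lower bound \<open>grow\<close> exceeds
    \<open>g 0\<close>, so a minimum over the ball is global.\<close>
  define R where "R = 2 * (\<bar>g 0\<bar> + \<bar>C\<bar>) / e"
  have R: "R \<ge> 0" using e by (simp add: R_def)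
  have cont: "continuous_on UNIV g"
    unfolding g_def using potentialD(1)[OF K]
    by (intro continuous_intros) (meson has_derivative_continuous_on has_derivative_at_withinI)
  obtain x where x: "x \<in> cball 0 R" "\<And>z. z \<in> cball 0 R \<Longrightarrow> g x \<le> g z"
    using continuous_attains_inf[of "cball 0 R" g] R continuous_on_subset[OF cont] by (metis compact_cball cball_eq_empty not_less subset_UNIV)
  have min: "g x \<le> g z" for z
  proof (cases "z \<in> cball 0 R")
    case False
    then have "norm z * e > 2 * (\<bar>g 0\<bar> + \<bar>C\<bar>)"
      using e by (simp add: R_def field_simps)
    then have "g 0 \<le> g z" using grow[of z] by (simp add: g_def algebra_simps)
    then show ?thesis using x(2)[of 0] R by simp
  qed (rule x(2))
  have "(g has_derivative (\<lambda>h. m x \<bullet> h - h \<bullet> y)) (at x)"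
    unfolding g_def by (intro has_derivative_diff potentialD(1)[OF K] has_derivative_inner_left has_derivative_ident)
  then have "(\<lambda>h. m x \<bullet> h - h \<bullet> y) = (\<lambda>h. 0)"
    using min by (intro has_derivative_local_min[of g]) auto
  from fun_cong[OF this, of "m x - y"] have "(m x - y) \<bullet> (m x - y) = 0"
    by (simp add: inner_diff_left inner_diff_right inner_commute)
  then show "y \<in> range m" by auto
qed

text \<open>The range of \<open>m\<close> lies between the interior of \<open>K\<close> and
  \<open>K\<close>, so the two differ only on the frontier, which is negligible for a convex
  set.\<close>

proposition volume_eq_integral_det:
  assumes K: "potential K f m H" and body: "convex_body K"
  shows "has_bochner_integral lebesgue (\<lambda>x. det (H x)) (measure lebesgue K)"
proof -
  have cK: "compact K" "convex K" using body by (auto simp: convex_body_def)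
  have "negligible (K - range m \<union> (range m - K))"
  proof (rule negligible_subset[OF negligible_convex_frontier[OF cK(2)]])
    show "K - range m \<union> (range m - K) \<subseteq> frontier K"
      using potential_interior_subset[OF K] potentialD(4)[OF K] closure_subset[of K]
      by (auto simp: frontier_def)
  qed
  then have "range m \<in> lmeasurable" "measure lebesgue (range m) = measure lebesgue K"
    using lmeasurable_negligible_symdiff measure_negligible_symdiff lmeasurable_compact[OF cK(1)] by blast+
  then show ?thesis
    using measure_range_eq_integral_det[OF potentialD(2)[OF K] potential_gradient_inj[OF K]]
      det_pos_of_pos_def[OF potentialD(3)[OF K]]
    by (simp add: less_imp_le)
qed

text \<open>For the probability density \<open>E x t / Z x\<close> on the box, \<open>m x\<close> is
  the mean of \<open>P\<close> and \<open>Dm x\<close> its covariance. A mean of points of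
  \<open>K\<close> lies in \<open>K\<close>, and the covariance is positive definite because
  \<open>P\<close> attains every point of \<open>K\<close>, which lies in no hyperplane.\<close>

lemma potential_exists:
  fixes K :: "(real^'n::finite) set"
  assumes body: "convex_body K"
  shows "\<exists>f m H. potential K f m H"
proof -
  have K: "compact K" "closed K" "convex K" "interior K \<noteq> {}" "K \<noteq> {}"
    using body interior_subset[of K] by (auto simp: convex_body_def compact_imp_closed)
  define P where "P = closest_point K"
  have P_in: "P t \<in> K" for t
    by (simp add: P_def K closest_point_in_set)
  have P_self: "P y = y" if "y \<in> K" for y
    using that by (simp add: P_def closest_point_self)
  have P_lip: "dist (P s) (P t) \<le> dist s t" for s t
    by (simp add: P_def K closest_point_lipschitz)
  have contP: "continuous_on S P" for S
    by (simp add: P_def K continuous_on_closest_point)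
  obtain B where B: "\<And>y. y \<in> K \<Longrightarrow> norm y \<le> B"
    using compact_imp_bounded[OF K(1)] by (auto simp: bounded_iff)
  \<comment> \<open>One unit of room around \<open>K\<close>: every ball of radius at most 1 about a
    point of \<open>K\<close> fits into the box.\<close>
  obtain a where a: "cball 0 (B + 1) \<subseteq> cbox (- a) (a :: real^'n)"
    using bounded_subset_cbox_symmetric[OF bounded_cball] by blast
  have sub: "cball y d \<subseteq> cbox (-a) a" if "y \<in> K" "d \<le> 1" for y d
  proof -
    have "cball y d \<subseteq> cball 0 (B + 1)"
      using B[OF that(1)] that(2) by (subst cball_subset_cball_iff) (auto simp: dist_norm)
    with a show ?thesis by blast
  qed
  obtain y0 where y0: "y0 \<in> K" using K(5) by blast
  have box_ne: "box (-a) a \<noteq> {}"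
  proof -
    have "ball y0 1 \<subseteq> interior (cbox (-a) a)"
      by (intro interior_maximal) (use sub[OF y0, of 1] ball_subset_cball in auto)
    then show ?thesis by (auto simp: interior_cbox)
  qed
  define E where "E x t = exp (x \<bullet> P t)" for x t
  define Z where "Z x = integral (cbox (-a) a) (E x)" for x
  define G where "G x = integral (cbox (-a) a) (\<lambda>t. E x t *\<^sub>R P t)" for x
  define DG where "DG x h = integral (cbox (-a) a) (\<lambda>t. (E x t * (h \<bullet> P t)) *\<^sub>R P t)" for x h
  have contE: "continuous_on S (E x)" for S x
    unfolding E_def by (intro continuous_intros contP)
  note ci = integrable_continuous continuous_intros contE contP
  have derZ: "(Z has_derivative (\<lambda>h. G x \<bullet> h)) (at x)" for x
  proof -
    \<comment> \<open>Differentiation under the integral takes place in the space of bounded linear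
      maps; the resulting integral is then evaluated at \<open>h\<close>.\<close>
    have "((\<lambda>x. integral (cbox (-a) a) (E x)) has_derivative
        integral (cbox (-a) a) (\<lambda>t. E x t *\<^sub>R blinfun_inner_left (P t))) (at x within UNIV)"
    proof (rule leibniz_rule)
      fix x t
      show "((\<lambda>x. E x t) has_derivative blinfun_apply (E x t *\<^sub>R blinfun_inner_left (P t))) (at x within UNIV)"
        unfolding E_def by (auto intro!: derivative_eq_intros simp: blinfun.scaleR_left)
      show "continuous_on (UNIV \<times> cbox (-a) a) (\<lambda>(x, t). E x t *\<^sub>R blinfun_inner_left (P t))"
        unfolding E_def split_def
        by (intro continuous_intros continuous_on_compose2[OF contP[of UNIV]]
            bounded_linear.continuous_on[OF bounded_linear_blinfun_inner_left]) auto
    qed (auto intro!: ci)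
    moreover have "blinfun_apply (integral (cbox (-a) a) (\<lambda>t. E x t *\<^sub>R blinfun_inner_left (P t))) h = G x \<bullet> h" for h
    proof -
      have "blinfun_apply (integral (cbox (-a) a) (\<lambda>t. E x t *\<^sub>R blinfun_inner_left (P t))) h
        = integral (cbox (-a) a) (\<lambda>t. blinfun_apply (E x t *\<^sub>R blinfun_inner_left (P t)) h)"
        by (intro blinfun_apply_integral ci bounded_linear.continuous_on[OF bounded_linear_blinfun_inner_left])
      also have "\<dots> = integral (cbox (-a) a) (\<lambda>t. (E x t *\<^sub>R P t) \<bullet> h)"
        by (simp add: blinfun.scaleR_left inner_commute)
      also have "\<dots> = G x \<bullet> h"
        unfolding G_def by (intro integral_linear[OF _ bounded_linear_inner_left, unfolded o_def] ci)
      finally show ?thesis .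
    qed
    then have "blinfun_apply (integral (cbox (-a) a) (\<lambda>t. E x t *\<^sub>R blinfun_inner_left (P t))) = (\<lambda>h. G x \<bullet> h)"
      by blast
    ultimately show ?thesis by (simp add: Z_def[abs_def])
  qed
  have derG: "(G has_derivative DG x) (at x)" for x
  proof -
    define L where "L t = blinfun_scaleR_left (P t) o\<^sub>L blinfun_inner_left (P t)" for t
    have L: "blinfun_apply (L t) h = (h \<bullet> P t) *\<^sub>R P t" for t h
      by (simp add: L_def)
    have contL: "continuous_on S L" for S
      unfolding L_def
      by (intro continuous_intros contP bounded_linear.continuous_on[OF bounded_linear_blinfun_inner_left]
         bounded_linear.continuous_on[OF bounded_linear_blinfun_scaleR_left])
    have "((\<lambda>x. integral (cbox (-a) a) (\<lambda>t. E x t *\<^sub>R P t)) has_derivative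
        integral (cbox (-a) a) (\<lambda>t. E x t *\<^sub>R L t)) (at x within UNIV)"
    proof (rule leibniz_rule)
      fix x t
      show "((\<lambda>x. E x t *\<^sub>R P t) has_derivative blinfun_apply (E x t *\<^sub>R L t)) (at x within UNIV)"
        unfolding E_def by (auto intro!: derivative_eq_intros simp: blinfun.scaleR_left L)
      show "continuous_on (UNIV \<times> cbox (-a) a) (\<lambda>(x, t). E x t *\<^sub>R L t)"
        unfolding E_def split_def
        by (intro continuous_intros continuous_on_compose2[OF contP[of UNIV]] continuous_on_compose2[OF contL[of UNIV]]) auto
    qed (auto intro!: ci)
    moreover have "blinfun_apply (integral (cbox (-a) a) (\<lambda>t. E x t *\<^sub>R L t)) = DG x"
    proof
      fix h
      have "blinfun_apply (integral (cbox (-a) a) (\<lambda>t. E x t *\<^sub>R L t)) h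
        = integral (cbox (-a) a) (\<lambda>t. blinfun_apply (E x t *\<^sub>R L t) h)"
        by (intro blinfun_apply_integral ci contL)
      then show "blinfun_apply (integral (cbox (-a) a) (\<lambda>t. E x t *\<^sub>R L t)) h = DG x h"
        by (simp add: DG_def blinfun.scaleR_left L)
    qed
    ultimately show ?thesis by (simp add: G_def[abs_def])
  qed
  \<comment> \<open>\<open>P\<close> is 1-Lipschitz and fixes \<open>y\<close>, so on
    \<open>cball y d\<close> it stays within \<open>d\<close> of \<open>y\<close>, and
    \<open>x \<bullet> P t\<close> falls below \<open>x \<bullet> y\<close> by at most
    \<open>d * norm x\<close>. The volume factor does not depend on \<open>y\<close>.\<close>
  have lower: "measure lebesgue (cball (0::real^'n) d) * exp (x \<bullet> y - d * norm x) \<le> Z x"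
    if y: "y \<in> K" and d: "0 < d" "d \<le> 1" for x y d
  proof -
    let ?c = "exp (x \<bullet> y - d * norm x)"
    have int: "(\<lambda>t. ?c * 1) integrable_on cball y d"
      by (intro integrable_on_mult_right) (simp add: lmeasurable_iff_integrable_on[symmetric])
    have "measure lebesgue (cball (0::real^'n) d) * ?c = integral (cball y d) (\<lambda>t. ?c * 1)"
    proof -
      have "measure lebesgue (cball (0::real^'n) d) = measure lebesgue (cball y d)"
        using d by (simp add: content_cball)
      also have "\<dots> = integral (cball y d) (\<lambda>t. 1)"
        by (rule lmeasure_integral[OF lmeasurable_cball])
      finally show ?thesis
        by (simp only: integral_mult_right) (simp only: mult.commute)
    qed
    also have "\<dots> = integral (cbox (-a) a) (\<lambda>t. if t \<in> cball y d then ?c * 1 else 0)"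
      unfolding Henstock_Kurzweil_Integration.integral_restrict_Int Int_absorb2[OF sub[OF y d(2)]] ..
    also have "\<dots> \<le> Z x"
      unfolding Z_def
    proof (rule integral_le)
      show "(\<lambda>t. if t \<in> cball y d then ?c * 1 else 0) integrable_on cbox (-a) a"
        unfolding Henstock_Kurzweil_Integration.integrable_restrict_Int Int_absorb2[OF sub[OF y d(2)]] by (rule int)
      show "E x integrable_on cbox (-a) a" by (intro ci)
      fix t
      show "(if t \<in> cball y d then ?c * 1 else 0) \<le> E x t"
      proof (cases "t \<in> cball y d")
        case True
        then have "norm (P t - y) \<le> d"
          using P_lip[of y t] P_self[OF y] by (simp add: dist_norm norm_minus_commute)
        then have "norm x * norm (P t - y) \<le> d * norm x"
          by (metis mult.commute mult_left_mono norm_ge_zero)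
        moreover have "- (x \<bullet> (P t - y)) \<le> norm x * norm (P t - y)"
          using Cauchy_Schwarz_ineq2[of x "P t - y"] by simp
        ultimately show ?thesis using True by (simp add: E_def inner_diff_right)
      qed (simp add: E_def)
    qed
    finally show ?thesis .
  qed
  have vpos: "measure lebesgue (cball (0::real^'n) d) > 0" if "d > 0" for d
    using that content_ball_pos[of d "0 :: real^'n"] by (simp add: content_cball_conv_ball)
  have Zpos: "Z x > 0" for x
    using lower[OF y0, of 1 x] vpos[of 1] by (smt (verit) exp_gt_zero mult_pos_pos)
  define f where "f x = ln (Z x)" for x
  define m where "m x = inverse (Z x) *\<^sub>R G x" for x
  define Dm where "Dm x h = inverse (Z x) *\<^sub>R DG x h - (inverse (Z x) * (G x \<bullet> h) * inverse (Z x)) *\<^sub>R G x" for x h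
  have derm: "(m has_derivative Dm x) (at x)" for x
    unfolding m_def Dm_def
    using Zpos[of x] by (auto intro!: derivative_eq_intros derZ derG)
  have "linear (Dm x)" for x using derm by (rule has_derivative_linear)
  then have mat: "(\<lambda>h. matrix (Dm x) *v h) = Dm x" for x
    by (simp add: fun_eq_iff matrix_works)
  have ip: "integral (cbox (-a) a) (\<lambda>t. h \<bullet> (w t *\<^sub>R P t)) = h \<bullet> integral (cbox (-a) a) (\<lambda>t. w t *\<^sub>R P t)"
    if "continuous_on (cbox (-a) a) w" for h w
    by (intro integral_linear[OF _ bounded_linear_inner_right, unfolded o_def] ci that)
  have "potential K f m (\<lambda>x. matrix (Dm x))"
    unfolding potential_def mat
  proof (intro conjI allI impI)
    fix x
    show "(f has_derivative (\<lambda>h. m x \<bullet> h)) (at x)"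
      unfolding f_def m_def
      using Zpos[of x] by (auto intro!: derivative_eq_intros derZ simp: divide_inverse)
    show "(m has_derivative Dm x) (at x)" by (rule derm)
    fix h :: "real^'n" assume h: "h \<noteq> 0"
    \<comment> \<open>The mean of \<open>h \<bullet> P\<close>; the integral \<open>?I\<close> is
      \<open>Z x\<close> times the variance.\<close>
    define \<mu> where "\<mu> = inverse (Z x) * (h \<bullet> G x)"
    let ?I = "integral (cbox (-a) a) (\<lambda>t. E x t * (h \<bullet> P t - \<mu>)\<^sup>2)"
    have 1: "integral (cbox (-a) a) (\<lambda>t. E x t * (h \<bullet> P t)) = h \<bullet> G x"
      unfolding G_def by (subst ip[symmetric]) (simp_all add: contE)
    have 2: "integral (cbox (-a) a) (\<lambda>t. E x t * (h \<bullet> P t)\<^sup>2) = h \<bullet> DG x h"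
      unfolding DG_def by (subst ip[symmetric]) (auto intro!: ci simp: power2_eq_square mult.assoc)
    have "?I = integral (cbox (-a) a) (\<lambda>t. E x t * (h \<bullet> P t)\<^sup>2 - 2 * \<mu> * (E x t * (h \<bullet> P t)) + \<mu>\<^sup>2 * E x t)"
      by (simp add: power2_diff algebra_simps)
    also have "\<dots> = h \<bullet> DG x h - 2 * \<mu> * (h \<bullet> G x) + \<mu>\<^sup>2 * Z x"
      unfolding 1[symmetric] 2[symmetric] Z_def
      by (subst integral_add integral_diff; (intro ci)?)+ simp
    also have "\<dots> = h \<bullet> DG x h - \<mu> * (h \<bullet> G x)"
      using Zpos[of x] by (simp add: \<mu>_def power2_eq_square field_simps)
    also have "\<dots> = Z x * (h \<bullet> Dm x h)"
      using Zpos[of x] by (simp add: Dm_def \<mu>_def inner_diff_right inner_commute field_simps)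
    finally have I: "?I = Z x * (h \<bullet> Dm x h)" .
    have "?I \<ge> 0"
      by (intro integral_nonneg ci) (simp add: E_def)
    moreover have "?I \<noteq> 0"
    proof
      assume "?I = 0"
      \<comment> \<open>A continuous nonnegative integrand with zero integral vanishes on the whole
        box, in particular on \<open>K\<close>, where \<open>P\<close> is the identity.\<close>
      then have "\<forall>t\<in>cbox (-a) a. E x t * (h \<bullet> P t - \<mu>)\<^sup>2 = 0"
        by (subst (asm) integral_cbox_eq_0_iff) (auto intro!: ci box_ne simp: E_def)
      then have const: "h \<bullet> y = \<mu>" if "y \<in> K" for y
        using sub[OF that, of 0] P_self[OF that] by (auto simp: E_def)
      obtain y r where yr: "r > 0" "cball y r \<subseteq> K"
        using K(4) by (metis equals0I mem_interior_cball)
      have "y \<in> K" "y + (r / norm h) *\<^sub>R h \<in> K"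
        using yr h by (auto simp: subset_eq dist_norm)
      from const[OF this(1)] const[OF this(2)] have "r / norm h * (h \<bullet> h) = 0"
        by (simp add: inner_add_right)
      with h yr show False by simp
    qed
    ultimately have "Z x * (h \<bullet> Dm x h) > 0" unfolding I by linarith
    then show "h \<bullet> Dm x h > 0"
      using Zpos[of x] by (simp add: zero_less_mult_iff)
  next
    \<comment> \<open>A half-space containing \<open>K\<close> contains all values of
      \<open>P\<close>, hence also their mean.\<close>
    show "range m \<subseteq> K"
    proof (rule ccontr)
      assume "\<not> range m \<subseteq> K"
      then obtain x where "m x \<notin> K" by blast
      then obtain u b where ub: "u \<bullet> m x < b" "\<And>y. y \<in> K \<Longrightarrow> u \<bullet> y > b"
        using separating_hyperplane_closed_point[OF K(3,2)] by metis
      have "b * Z x = integral (cbox (-a) a) (\<lambda>t. b * E x t)" by (simp add: Z_def)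
      also have "\<dots> \<le> integral (cbox (-a) a) (\<lambda>t. u \<bullet> (E x t *\<^sub>R P t))"
        by (intro integral_le ci) (use ub(2)[OF P_in] in \<open>auto simp: E_def mult.commute less_imp_le\<close>)
      also have "\<dots> = u \<bullet> G x" unfolding G_def by (intro ip contE)
      finally show False using ub(1) Zpos[of x] by (simp add: m_def field_simps)
    qed
  next
    fix e :: real assume "e > 0"
    \<comment> \<open>The cap at 1 keeps the ball inside the box. The additive constant of the
      growth bound becomes \<open>- ln v\<close>.\<close>
    define d where "d = min e 1"
    define v where "v = measure lebesgue (cball (0::real^'n) d)"
    have d: "0 < d" "d \<le> 1" "d \<le> e" using \<open>e > 0\<close> by (auto simp: d_def)
    have v: "v > 0" unfolding v_def by (intro vpos d)
    have "x \<bullet> y - e * norm x - (- ln v) \<le> f x" if "y \<in> K" for x y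
    proof -
      have "ln (v * exp (x \<bullet> y - d * norm x)) \<le> f x"
        unfolding f_def using lower[OF that d(1,2), of x] v Zpos[of x] by (subst ln_le_cancel_iff) (auto simp: v_def)
      then have "ln v + (x \<bullet> y - d * norm x) \<le> f x" using v by (simp add: ln_mult)
      moreover have "d * norm x \<le> e * norm x" using d(3) by (intro mult_right_mono) auto
      ultimately show ?thesis by simp
    qed
    then show "\<exists>C. \<forall>x. \<forall>y\<in>K. x \<bullet> y - e * norm x - C \<le> f x" by blast
  qed
  then show ?thesis by blast
qed

subsection \<open>Mixed discriminants and polarized volume\<close>

lemma sum_Pow_insert:
  fixes F :: "'a set \<Rightarrow> 'b::comm_monoid_add"
  assumes "finite S" "k \<notin> S"
  shows "sum F (Pow (insert k S)) = (\<Sum>I\<in>Pow S. F I + F (insert k I))"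
proof -
  have "inj_on (insert k) (Pow S)"
    using assms(2) by (auto simp: inj_on_def)
  then show ?thesis
    using assms unfolding Pow_insert
    by (subst sum.union_disjoint) (auto simp: sum.reindex sum.distrib)
qed

lemma finite_funs_into: "finite S \<Longrightarrow> finite {f :: 'n::finite \<Rightarrow> 'b. \<forall>a. f a \<in> S}"
  using finite_PiE[of "UNIV :: 'n set" "\<lambda>_. S"] by (simp add: PiE_UNIV_domain Pi_def)

text \<open>Up to the factor \<open>n!\<close> this is the mixed discriminant of \<open>n\<close> matrices.\<close>

definition mixed_det :: "(nat \<Rightarrow> real^'n::finite^'n) \<Rightarrow> real" where
  "mixed_det A = (\<Sum>\<sigma> | bij_betw \<sigma> (UNIV :: 'n set) {..<CARD('n)}. det (\<chi> a. A (\<sigma> a) $ a))"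

text \<open>Expanding a determinant row by row gives a sum over the choices \<open>f\<close> of a
  matrix for each row. Moebius inversion over subsets isolates the choices that use all
  \<open>n\<close> matrices; with \<open>n\<close> rows these are the bijections.\<close>

lemma mixed_det_polarization:
  fixes A :: "nat \<Rightarrow> real^'n::finite^'n"
  shows "(\<Sum>I\<in>Pow {..<CARD('n)}. (-1) ^ (CARD('n) - card I) * det (\<Sum>i\<in>I. A i)) = mixed_det A"
proof -
  define D where "D f = det (\<chi> a. A (f a) $ a)" for f :: "'n \<Rightarrow> nat"
  have expand: "det (\<Sum>i\<in>S. A i) = (\<Sum>f | \<forall>a. f a \<in> S. D f)" if "finite S" for S
  proof -
    have eq: "PiE UNIV (\<lambda>_. S) = {f :: 'n \<Rightarrow> nat. \<forall>a. f a \<in> S}"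
      by auto
    have "(\<Prod>a\<in>UNIV. (\<Sum>i\<in>S. A i) $ a $ p a) = (\<Sum>f | \<forall>a. f a \<in> S. \<Prod>a\<in>UNIV. A (f a) $ a $ p a)"
      for p :: "'n \<Rightarrow> 'n"
      using prod_sum_PiE[of "UNIV :: 'n set" "\<lambda>_. S" "\<lambda>a i. A i $ a $ p a"] that
      by (simp add: eq)
    then have "det (\<Sum>i\<in>S. A i) = (\<Sum>p | p permutes UNIV. \<Sum>f | \<forall>a. f a \<in> S.
        of_int (sign p) * (\<Prod>a\<in>UNIV. A (f a) $ a $ p a))"
      by (simp add: det_def sum_distrib_left)
    then show ?thesis
      by (subst (asm) sum.swap) (simp add: D_def det_def)
  qed
  have "(\<Sum>f | \<forall>a. f a \<in> S. D f) = (\<Sum>T\<in>Pow S. \<Sum>f | range f = T. D f)" if S: "finite S" for S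
  proof -
    have "(\<Sum>f | \<forall>a. f a \<in> S. D f) = (\<Sum>T\<in>Pow S. \<Sum>f \<in> {f \<in> {f. \<forall>a. f a \<in> S}. range f = T}. D f)"
      by (rule sum.group[symmetric]) (use S finite_funs_into[OF S] in auto)
    also have "\<dots> = (\<Sum>T\<in>Pow S. \<Sum>f | range f = T. D f)"
      by (intro sum.cong) auto
    finally show ?thesis .
  qed
  then have "(\<Sum>f | range f = {..<CARD('n)}. D f) =
      (\<Sum>I\<in>Pow {..<CARD('n)}. (-1) ^ (card {..<CARD('n)} - card I) * (\<Sum>f | \<forall>a. f a \<in> I. D f))"
    by (rule inclusion_exclusion_mobius) auto
  also have "\<dots> = (\<Sum>I\<in>Pow {..<CARD('n)}. (-1) ^ (CARD('n) - card I) * det (\<Sum>i\<in>I. A i))"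
    by (intro sum.cong refl) (auto simp: expand finite_subset)
  also have "{f. range f = {..<CARD('n)}} = {\<sigma>. bij_betw \<sigma> (UNIV :: 'n set) {..<CARD('n)}}"
    by (auto simp: bij_betw_def intro!: eq_card_imp_inj_on)
  finally show ?thesis by (simp add: mixed_det_def D_def)
qed

lemma bij_betw_unique_preimage:
  assumes "bij_betw \<sigma> (UNIV :: 'n set) {..<m::nat}" "k < m"
  obtains b where "\<And>a. \<sigma> a = k \<longleftrightarrow> a = b"
  using assms unfolding bij_betw_def inj_on_def by (metis UNIV_I imageE lessThan_iff)

text \<open>A bijection \<open>\<sigma>\<close> takes exactly one row from matrix \<open>k\<close>,
  and the determinant is additive in that row.\<close>

lemma mixed_det_add:
  fixes A :: "nat \<Rightarrow> real^'n::finite^'n"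
  assumes k: "k < CARD('n)"
  shows "mixed_det (A(k := B + C)) = mixed_det (A(k := B)) + mixed_det (A(k := C))"
  unfolding mixed_det_def sum.distrib[symmetric]
proof (rule sum.cong[OF refl])
  fix \<sigma> assume "\<sigma> \<in> {\<sigma>. bij_betw \<sigma> (UNIV :: 'n set) {..<CARD('n)}}"
  then obtain b where b: "\<And>a. \<sigma> a = k \<longleftrightarrow> a = b"
    using bij_betw_unique_preimage k by (metis mem_Collect_eq)
  have *: "(\<chi> a. (A(k := X)) (\<sigma> a) $ a) = (\<chi> a. if a = b then X $ a else A (\<sigma> a) $ a)" for X
    by (simp add: vec_eq_iff b)
  show "det (\<chi> a. (A(k := B + C)) (\<sigma> a) $ a) =
      det (\<chi> a. (A(k := B)) (\<sigma> a) $ a) + det (\<chi> a. (A(k := C)) (\<sigma> a) $ a)"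
    unfolding * using det_row_add[of b "\<lambda>a. B $ a" "\<lambda>a. C $ a" "\<lambda>a. A (\<sigma> a) $ a"]
    by (simp cong: if_cong)
qed

lemma mixed_det_scaleR:
  fixes A :: "nat \<Rightarrow> real^'n::finite^'n"
  assumes k: "k < CARD('n)"
  shows "mixed_det (A(k := c *\<^sub>R B)) = c * mixed_det (A(k := B))"
  unfolding mixed_det_def sum_distrib_left
proof (rule sum.cong[OF refl])
  fix \<sigma> assume "\<sigma> \<in> {\<sigma>. bij_betw \<sigma> (UNIV :: 'n set) {..<CARD('n)}}"
  then obtain b where b: "\<And>a. \<sigma> a = k \<longleftrightarrow> a = b"
    using bij_betw_unique_preimage k by (metis mem_Collect_eq)
  have *: "(\<chi> a. (A(k := X)) (\<sigma> a) $ a) = (\<chi> a. if a = b then X $ a else A (\<sigma> a) $ a)" for X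
    by (simp add: vec_eq_iff b)
  show "det (\<chi> a. (A(k := c *\<^sub>R B)) (\<sigma> a) $ a) = c * det (\<chi> a. (A(k := B)) (\<sigma> a) $ a)"
    unfolding * using det_row_mul[of b c "\<lambda>a. B $ a" "\<lambda>a. A (\<sigma> a) $ a"]
    by (simp add: scalar_mult_eq_scaleR cong: if_cong)
qed

lemma mixed_det_const:
  fixes H :: "real^'n::finite^'n"
  shows "mixed_det (\<lambda>_. H) = fact CARD('n) * det H"
proof -
  obtain \<sigma>0 :: "'n \<Rightarrow> nat" where s0: "bij_betw \<sigma>0 UNIV {..<CARD('n)}"
    using ex_bij_betw_finite_nat[of "UNIV :: 'n set"] by (auto simp: atLeast0LessThan)
  have "bij_betw (\<lambda>p. \<sigma>0 \<circ> p) {p. p permutes UNIV} {\<sigma>. bij_betw \<sigma> UNIV {..<CARD('n)}}"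
  proof (rule bij_betw_byWitness[of _ "\<lambda>\<sigma>. inv \<sigma>0 \<circ> \<sigma>"])
    have inj: "inj \<sigma>0" using s0 by (simp add: bij_betw_def)
    then show "\<forall>p\<in>{p. p permutes UNIV}. inv \<sigma>0 \<circ> (\<sigma>0 \<circ> p) = p"
      by (simp add: fun_eq_iff)
    show "\<forall>\<sigma>\<in>{\<sigma>. bij_betw \<sigma> UNIV {..<CARD('n)}}. \<sigma>0 \<circ> (inv \<sigma>0 \<circ> \<sigma>) = \<sigma>"
      using s0 by (auto simp: fun_eq_iff bij_betw_def intro!: f_inv_into_f)
    show "(\<lambda>p. \<sigma>0 \<circ> p) ` {p. p permutes UNIV} \<subseteq> {\<sigma>. bij_betw \<sigma> UNIV {..<CARD('n)}}"
      using s0 by (auto intro: bij_betw_trans dest: permutes_imp_bij)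
    show "(\<lambda>\<sigma>. inv \<sigma>0 \<circ> \<sigma>) ` {\<sigma>. bij_betw \<sigma> UNIV {..<CARD('n)}} \<subseteq> {p. p permutes UNIV}"
      using bij_betw_inv_into[OF s0] by (auto intro!: bij_imp_permutes intro: bij_betw_trans)
  qed
  then have "card {\<sigma>. bij_betw \<sigma> (UNIV :: 'n set) {..<CARD('n)}} = fact CARD('n)"
    using bij_betw_same_card card_permutations[of "UNIV :: 'n set"] by fastforce
  then show ?thesis by (simp add: mixed_det_def)
qed

section \<open>Minkowski sums of bodies and the polarized volume\<close>

lemma convex_body_plus:
  assumes "convex_body K" "convex_body L"
  shows "convex_body (K + L)"
  unfolding convex_body_def
proof (intro conjI)
  show "compact (K + L)"
    using compact_sums'[of K L] assms by (auto simp: convex_body_def set_plus_def Bex_def conj_ac elim!: back_subst[of compact])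
  show "convex (K + L)"
    using assms by (simp add: convex_body_def convex_set_plus)
  obtain y where y: "y \<in> L"
    using assms(2) interior_subset by (auto simp: convex_body_def)
  have "(+) y ` K \<subseteq> K + L"
    using y by (auto simp: add.commute)
  then have "interior ((+) y ` K) \<subseteq> interior (K + L)"
    by (rule interior_mono)
  then show "interior (K + L) \<noteq> {}"
    using assms(1) by (auto simp: convex_body_def interior_translation)
qed

lemma convex_body_scaleR:
  assumes "convex_body K" "c \<noteq> 0"
  shows "convex_body ((\<lambda>x. c *\<^sub>R x) ` K)"
  using assms interior_injective_linear_image[of "\<lambda>x. c *\<^sub>R x" K]
  by (auto simp: convex_body_def compact_scaling convex_scaling inj_def)

text \<open>The empty sum is \<open>{0}\<close>, which has no interior; hence the nonempty index
  set.\<close>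

lemma convex_body_sum:
  "finite I \<Longrightarrow> I \<noteq> {} \<Longrightarrow> (\<And>i. i \<in> I \<Longrightarrow> convex_body (A i)) \<Longrightarrow> convex_body (\<Sum>i\<in>I. A i)"
  by (induction I rule: finite_ne_induct) (auto intro!: convex_body_plus)

lemma potential_sum:
  "finite I \<Longrightarrow> I \<noteq> {} \<Longrightarrow> (\<And>i. i \<in> I \<Longrightarrow> potential (A i) (f i) (m i) (H i)) \<Longrightarrow>
     potential (\<Sum>i\<in>I. A i) (\<lambda>x. \<Sum>i\<in>I. f i x) (\<lambda>x. \<Sum>i\<in>I. m i x) (\<lambda>x. \<Sum>i\<in>I. H i x)"
  by (induction I rule: finite_ne_induct) (auto intro!: potential_add)

text \<open>The polarization formula for the mixed volume, extended to arbitrary sets.\<close>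

definition mvol :: "(nat \<Rightarrow> (real^'n::finite) set) \<Rightarrow> real" where
  "mvol A = (\<Sum>I\<in>Pow {..<CARD('n)}. (-1) ^ (CARD('n) - card I) * measure lebesgue (\<Sum>i\<in>I. A i)) / fact CARD('n)"

text \<open>Polarization acts on both sides at once: each volume in \<open>mvol\<close> is the
  integral of the determinant of a sum of Hessians, and the signed combination of these integrands
  is \<open>mixed_det\<close>.\<close>

lemma mvol_eq_integral:
  fixes A :: "nat \<Rightarrow> (real^'n::finite) set"
  assumes body: "\<And>i. i < CARD('n) \<Longrightarrow> convex_body (A i)"
    and pot: "\<And>i. i < CARD('n) \<Longrightarrow> potential (A i) (f i) (m i) (H i)"
  shows "has_bochner_integral lebesgue (\<lambda>x. mixed_det (\<lambda>i. H i x)) (fact CARD('n) * mvol A)"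
proof -
  have "has_bochner_integral lebesgue (\<lambda>x. det (\<Sum>i\<in>I. H i x)) (measure lebesgue (\<Sum>i\<in>I. A i))"
    if "I \<in> Pow {..<CARD('n)}" for I
  proof (cases "I = {}")
    \<comment> \<open>The empty Minkowski sum \<open>{0}\<close> has volume zero, matching the
      determinant of the empty matrix sum.\<close>
    case True
    have "det (0 :: real^'n^'n) = 0"
      by (rule det_zero_row(1)[of undefined]) (simp add: row_def vec_eq_iff)
    then show ?thesis using True by (simp add: has_bochner_integral_zero)
  next
    case False
    have "finite I" using that finite_subset by auto
    then show ?thesis
      using that False
      by (intro volume_eq_integral_det[OF potential_sum[of I A f m H]] convex_body_sum body pot) auto
  qed
  then have "has_bochner_integral lebesgue
      (\<lambda>x. \<Sum>I\<in>Pow {..<CARD('n)}. (-1) ^ (CARD('n) - card I) * det (\<Sum>i\<in>I. H i x))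
      (\<Sum>I\<in>Pow {..<CARD('n)}. (-1) ^ (CARD('n) - card I) * measure lebesgue (\<Sum>i\<in>I. A i))"
    by (intro has_bochner_integral_sum has_bochner_integral_mult_right)
  then show ?thesis by (simp add: mixed_det_polarization mvol_def)
qed

lemma mvol_cong:
  fixes A :: "nat \<Rightarrow> (real^'n::finite) set"
  assumes "\<And>i. i < CARD('n) \<Longrightarrow> A i = B i"
  shows "mvol A = mvol B"
proof -
  have "(\<Sum>i\<in>I. A i) = (\<Sum>i\<in>I. B i)" if "I \<in> Pow {..<CARD('n)}" for I
    using that assms by (intro sum.cong) auto
  then show ?thesis unfolding mvol_def by simp
qed

text \<open>Pair \<open>I\<close> with \<open>insert k I\<close>: the Minkowski sum is the same and
  the sign is opposite.\<close>

lemma mvol_zero: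
  fixes A :: "nat \<Rightarrow> (real^'n::finite) set"
  assumes k: "k < CARD('n)" and A: "A k = {0}"
  shows "mvol A = 0"
proof -
  let ?S = "{..<CARD('n)} - {k}"
  let ?F = "\<lambda>I. (-1) ^ (CARD('n) - card I) * measure lebesgue (\<Sum>i\<in>I. A i)"
  have S: "insert k ?S = {..<CARD('n)}" using k by auto
  have "sum ?F (Pow (insert k ?S)) = (\<Sum>I\<in>Pow ?S. ?F I + ?F (insert k I))"
    by (rule sum_Pow_insert) auto
  also have "\<dots> = 0"
  proof (rule sum.neutral, rule ballI)
    fix I assume I: "I \<in> Pow ?S"
    then have fin: "finite I" and k': "k \<notin> I" using finite_subset by auto
    have "card I \<le> card ?S" using I by (intro card_mono) auto
    then have "card I < CARD('n)" using k by simp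
    then have "CARD('n) - card I = Suc (CARD('n) - card (insert k I))"
      using fin k' by simp
    moreover have "(\<Sum>i\<in>insert k I. A i) = (\<Sum>i\<in>I. A i)"
      using fin k' A by (simp add: set_zero[symmetric] del: set_zero)
    ultimately show "?F I + ?F (insert k I) = 0" by simp
  qed
  finally show ?thesis unfolding S by (simp add: mvol_def)
qed

text \<open>Permuting the slots only permutes the index sets of the polarization sum, with
  cardinalities preserved.\<close>

lemma mvol_permute:
  fixes A :: "nat \<Rightarrow> (real^'n::finite) set"
  assumes p: "p permutes {..<CARD('n)}"
  shows "mvol (\<lambda>i. A (p i)) = mvol A"
proof -
  let ?F = "\<lambda>I. (-1) ^ (CARD('n) - card I) * measure lebesgue (\<Sum>i\<in>I. A i)"
  have inj: "inj_on p I" for I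
    using permutes_inj[OF p] inj_on_subset by blast
  have "bij_betw ((`) p) (Pow {..<CARD('n)}) (Pow {..<CARD('n)})"
    by (rule bij_betw_Pow[OF permutes_imp_bij[OF p]])
  then have "sum ?F (Pow {..<CARD('n)}) = (\<Sum>I\<in>Pow {..<CARD('n)}. ?F (p ` I))"
    by (rule sum.reindex_bij_betw[symmetric])
  then show ?thesis
    by (simp add: mvol_def sum.reindex[OF inj] card_image[OF inj] o_def)
qed

lemma mvol_reflect:
  fixes A :: "nat \<Rightarrow> (real^'n::finite) set"
  shows "mvol (\<lambda>i. uminus ` A i) = mvol A"
proof -
  have plus: "uminus ` X + uminus ` Y = uminus ` (X + Y)" for X Y :: "(real^'n) set"
  proof (intro set_eqI iffI)
    fix x assume "x \<in> uminus ` X + uminus ` Y"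
    then obtain a b where "a \<in> X" "b \<in> Y" "x = - a + - b" by (auto elim!: set_plus_elim)
    then have "x = - (a + b)" "a + b \<in> X + Y" by auto
    then show "x \<in> uminus ` (X + Y)" by blast
  next
    fix x assume "x \<in> uminus ` (X + Y)"
    then obtain a b where "a \<in> X" "b \<in> Y" "x = - a + - b" by (auto elim!: set_plus_elim)
    then show "x \<in> uminus ` X + uminus ` Y" by (simp only:) (intro set_plus_intro imageI)
  qed
  have "(\<Sum>i\<in>I. uminus ` A i) = uminus ` (\<Sum>i\<in>I. A i)" for I
    using sum_set_linear[of "(`) uminus" A I] plus by (simp add: o_def)
  moreover have "measure lebesgue (uminus ` S) = measure lebesgue S" for S :: "(real^'n) set"
    using measure_lebesgue_affine[of "-1" 0 S] by simp
  ultimately show ?thesis by (simp add: mvol_def)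
qed

text \<open>A singleton has no potential, but \<open>mvol\<close> vanishes as soon as one entry is \<open>{0}\<close>, so multilinearity
  extends to scaling by \<open>0\<close>.\<close>

definition body_or_point :: "(real^'n::finite) set \<Rightarrow> bool" where
  "body_or_point K \<longleftrightarrow> convex_body K \<or> K = {0}"

lemma body_or_point_simps [simp]:
  "body_or_point {0}" "convex_body K \<Longrightarrow> body_or_point K"
  by (simp_all add: body_or_point_def)

lemma body_or_point_plus:
  "body_or_point K \<Longrightarrow> body_or_point L \<Longrightarrow> body_or_point (K + L)"
  by (auto simp: body_or_point_def set_zero[symmetric] convex_body_plus simp del: set_zero)

lemma scaleR_zero_image:
  assumes "body_or_point K" shows "(\<lambda>x. 0 *\<^sub>R x) ` K = {0}"
  using assms interior_subset by (auto simp: body_or_point_def convex_body_def)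

lemma body_or_point_scaleR:
  assumes "body_or_point K" shows "body_or_point ((\<lambda>x. c *\<^sub>R x) ` K)"
  using assms scaleR_zero_image[OF assms]
  by (cases "c = 0") (auto simp: body_or_point_def convex_body_scaleR)

lemma body_or_point_sum:
  "finite I \<Longrightarrow> (\<And>i. i \<in> I \<Longrightarrow> body_or_point (A i)) \<Longrightarrow> body_or_point (\<Sum>i\<in>I. A i)"
  by (induction I rule: finite_induct) (auto intro!: body_or_point_plus)

lemma potential_family:
  assumes "\<And>i. P i \<Longrightarrow> convex_body (A i)"
  obtains f m H where "\<And>i. P i \<Longrightarrow> potential (A i) (f i) (m i) (H i)"
proof -
  have "\<forall>i. \<exists>t. P i \<longrightarrow> potential (A i) (fst t) (fst (snd t)) (snd (snd t))"
    using assms potential_exists by fastforce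
  then obtain t where "\<forall>i. P i \<longrightarrow> potential (A i) (fst (t i)) (fst (snd (t i))) (snd (snd (t i)))"
    by (rule choice[THEN exE])
  then show ?thesis by (intro that[of "\<lambda>i. fst (t i)"]) blast
qed

text \<open>If one of the sets is \<open>{0}\<close>, the claim reduces to \<open>mvol_zero\<close>.
  Otherwise \<open>potential_add\<close> lets one integrand represent both sides, and an integral
  has only one value.\<close>

lemma mvol_add:
  fixes A :: "nat \<Rightarrow> (real^'n::finite) set"
  assumes A: "\<And>i. i < CARD('n) \<Longrightarrow> i \<noteq> k \<Longrightarrow> body_or_point (A i)"
    and K: "body_or_point K" and L: "body_or_point L" and k: "k < CARD('n)"
  shows "mvol (A(k := K + L)) = mvol (A(k := K)) + mvol (A(k := L))"
proof (cases "(\<forall>i<CARD('n). i \<noteq> k \<longrightarrow> convex_body (A i)) \<and> convex_body K \<and> convex_body L")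
  case False
  then consider i where "i < CARD('n)" "i \<noteq> k" "A i = {0}" | "K = {0}" | "L = {0}"
    using assms by (auto simp: body_or_point_def)
  then show ?thesis
  proof cases
    case 1
    then show ?thesis using mvol_zero[of i "A(k := X)" for X] by simp
  next
    case 2
    then show ?thesis using mvol_zero[of k "A(k := {0})"] k
      by (simp add: set_zero[symmetric] del: set_zero)
  next
    case 3
    then show ?thesis using mvol_zero[of k "A(k := {0})"] k
      by (simp add: set_zero[symmetric] del: set_zero)
  qed
next
  case True
  then obtain f m H where pot: "\<And>i. i < CARD('n) \<and> i \<noteq> k \<Longrightarrow> potential (A i) (f i) (m i) (H i)"
    using potential_family[of "\<lambda>i. i < CARD('n) \<and> i \<noteq> k" A] by blast
  obtain fK mK HK where potK: "potential K fK mK HK" using True potential_exists by blast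
  obtain fL mL HL where potL: "potential L fL mL HL" using True potential_exists by blast
  have int: "has_bochner_integral lebesgue (\<lambda>x. mixed_det ((\<lambda>i. H i x)(k := HX x))) (fact CARD('n) * mvol (A(k := X)))"
    if "potential X fX mX HX" "convex_body X" for X fX mX HX
  proof -
    have "has_bochner_integral lebesgue (\<lambda>x. mixed_det (\<lambda>i. (H(k := HX)) i x)) (fact CARD('n) * mvol (A(k := X)))"
      using that pot True
      by (intro mvol_eq_integral[where f = "f(k := fX)" and m = "m(k := mX)"]) auto
    moreover have "(\<lambda>i. (H(k := HX)) i x) = (\<lambda>i. H i x)(k := HX x)" for x
      by auto
    ultimately show ?thesis by simp
  qed
  have "has_bochner_integral lebesgue (\<lambda>x. mixed_det ((\<lambda>i. H i x)(k := HK x + HL x)))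
      (fact CARD('n) * mvol (A(k := K)) + fact CARD('n) * mvol (A(k := L)))"
    unfolding mixed_det_add[OF k]
    by (intro has_bochner_integral_add int[OF potK] int[OF potL]) (use True in auto)
  moreover have "has_bochner_integral lebesgue (\<lambda>x. mixed_det ((\<lambda>i. H i x)(k := HK x + HL x)))
      (fact CARD('n) * mvol (A(k := K + L)))"
    by (intro int[OF potential_add[OF potK potL]] convex_body_plus) (use True in auto)
  ultimately have "fact CARD('n) * mvol (A(k := K + L)) =
      fact CARD('n) * mvol (A(k := K)) + fact CARD('n) * mvol (A(k := L))"
    by (rule has_bochner_integral_eq[rotated])
  then show ?thesis by (simp flip: distrib_left)
qed

text \<open>Potentials scale by positive factors; the factor 0 collapses \<open>K\<close> to
  \<open>{0}\<close> and falls under \<open>mvol_zero\<close>.\<close>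

lemma mvol_scaleR:
  fixes A :: "nat \<Rightarrow> (real^'n::finite) set"
  assumes A: "\<And>i. i < CARD('n) \<Longrightarrow> i \<noteq> k \<Longrightarrow> body_or_point (A i)"
    and K: "body_or_point K" and c: "c \<ge> 0" and k: "k < CARD('n)"
  shows "mvol (A(k := (\<lambda>x. c *\<^sub>R x) ` K)) = c * mvol (A(k := K))"
proof (cases "(\<forall>i<CARD('n). i \<noteq> k \<longrightarrow> convex_body (A i)) \<and> convex_body K \<and> c \<noteq> 0")
  case False
  then consider i where "i < CARD('n)" "i \<noteq> k" "A i = {0}" | "K = {0}" | "c = 0"
    using assms by (auto simp: body_or_point_def)
  then show ?thesis
  proof cases
    case 1
    then show ?thesis using mvol_zero[of i "A(k := X)" for X] by simp
  next
    case 2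
    then show ?thesis using mvol_zero[of k "A(k := {0})"] k by simp
  next
    case 3
    then show ?thesis using mvol_zero[of k "A(k := {0})"] k scaleR_zero_image[OF K] by simp
  qed
next
  case True
  then obtain f m H where pot: "\<And>i. i < CARD('n) \<and> i \<noteq> k \<Longrightarrow> potential (A i) (f i) (m i) (H i)"
    using potential_family[of "\<lambda>i. i < CARD('n) \<and> i \<noteq> k" A] by blast
  obtain fK mK HK where potK: "potential K fK mK HK" using True potential_exists by blast
  have int: "has_bochner_integral lebesgue (\<lambda>x. mixed_det ((\<lambda>i. H i x)(k := HX x))) (fact CARD('n) * mvol (A(k := X)))"
    if "potential X fX mX HX" "convex_body X" for X fX mX HX
  proof -
    have "has_bochner_integral lebesgue (\<lambda>x. mixed_det (\<lambda>i. (H(k := HX)) i x)) (fact CARD('n) * mvol (A(k := X)))"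
      using that pot True
      by (intro mvol_eq_integral[where f = "f(k := fX)" and m = "m(k := mX)"]) auto
    moreover have "(\<lambda>i. (H(k := HX)) i x) = (\<lambda>i. H i x)(k := HX x)" for x
      by auto
    ultimately show ?thesis by simp
  qed
  have "has_bochner_integral lebesgue (\<lambda>x. mixed_det ((\<lambda>i. H i x)(k := c *\<^sub>R HK x)))
      (c * (fact CARD('n) * mvol (A(k := K))))"
    unfolding mixed_det_scaleR[OF k]
    by (intro has_bochner_integral_mult_right int[OF potK]) (use True in auto)
  moreover have "has_bochner_integral lebesgue (\<lambda>x. mixed_det ((\<lambda>i. H i x)(k := c *\<^sub>R HK x)))
      (fact CARD('n) * mvol (A(k := (\<lambda>x. c *\<^sub>R x) ` K)))"
    by (intro int[OF potential_scaleR[OF potK]] convex_body_scaleR) (use True c in auto)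
  ultimately have "fact CARD('n) * mvol (A(k := (\<lambda>x. c *\<^sub>R x) ` K)) = c * (fact CARD('n) * mvol (A(k := K)))"
    by (rule has_bochner_integral_eq[rotated])
  then show ?thesis by simp
qed

text \<open>For a constant family \<open>mixed_det\<close> is a factorial times the determinant, and
  the normalization of \<open>mvol\<close> cancels this factorial.\<close>

lemma mvol_const:
  fixes K :: "(real^'n::finite) set"
  assumes "body_or_point K"
  shows "mvol (\<lambda>_. K) = measure lebesgue K"
proof (cases "convex_body K")
  case True
  then obtain f m H where pot: "potential K f m H" using potential_exists by blast
  have "has_bochner_integral lebesgue (\<lambda>x. mixed_det (\<lambda>_. H x)) (fact CARD('n) * mvol (\<lambda>_. K))"
    by (rule mvol_eq_integral[of "\<lambda>_. K" "\<lambda>_. f" "\<lambda>_. m" "\<lambda>_. H"]) (simp_all add: True pot)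
  moreover have "has_bochner_integral lebesgue (\<lambda>x. mixed_det (\<lambda>_. H x)) (fact CARD('n) * measure lebesgue K)"
    unfolding mixed_det_const
    by (intro has_bochner_integral_mult_right volume_eq_integral_det[OF pot True])
  ultimately have "fact CARD('n) * mvol (\<lambda>_. K) = fact CARD('n) * measure lebesgue K"
    by (rule has_bochner_integral_eq)
  then show ?thesis by simp
next
  case False
  then have "K = {0}" using assms by (simp add: body_or_point_def)
  then show ?thesis using mvol_zero[of 0 "\<lambda>_. K"] by simp
qed

subsection \<open>Minkowski expansion\<close>

lemma mvol_sum:
  fixes A :: "nat \<Rightarrow> (real^'n::finite) set"
  assumes "finite S" and k: "k < CARD('n)"
    and A: "\<And>i. i < CARD('n) \<Longrightarrow> i \<noteq> k \<Longrightarrow> body_or_point (A i)"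
    and B: "\<And>i. i \<in> S \<Longrightarrow> body_or_point (B i)" and c: "\<And>i. 0 \<le> c i"
  shows "mvol (A(k := \<Sum>i\<in>S. (\<lambda>x. c i *\<^sub>R x) ` B i)) = (\<Sum>i\<in>S. c i * mvol (A(k := B i)))"
  using assms(1) B
proof (induction S rule: finite_induct)
  case empty
  have "mvol (A(k := {0})) = 0" by (rule mvol_zero[OF k]) simp
  then show ?case by (simp only: sum.empty set_zero)
next
  case (insert j S)
  have "mvol (A(k := \<Sum>i\<in>insert j S. (\<lambda>x. c i *\<^sub>R x) ` B i)) =
      mvol (A(k := (\<lambda>x. c j *\<^sub>R x) ` B j + (\<Sum>i\<in>S. (\<lambda>x. c i *\<^sub>R x) ` B i)))"
    using insert.hyps by simp
  also have "\<dots> = mvol (A(k := (\<lambda>x. c j *\<^sub>R x) ` B j)) + mvol (A(k := \<Sum>i\<in>S. (\<lambda>x. c i *\<^sub>R x) ` B i))"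
    using insert by (intro mvol_add A k body_or_point_sum body_or_point_scaleR) auto
  also have "mvol (A(k := (\<lambda>x. c j *\<^sub>R x) ` B j)) = c j * mvol (A(k := B j))"
    using insert by (intro mvol_scaleR A c k) auto
  also have "mvol (A(k := \<Sum>i\<in>S. (\<lambda>x. c i *\<^sub>R x) ` B i)) = (\<Sum>i\<in>S. c i * mvol (A(k := B i)))"
    using insert by (intro insert.IH) auto
  finally show ?case unfolding sum.insert[OF insert.hyps] .
qed

lemma sum_words_Suc:
  fixes F :: "'a list \<Rightarrow> 'b::comm_monoid_add"
  shows "(\<Sum>w | set w \<subseteq> S \<and> length w = Suc k. F w) =
    (\<Sum>w | set w \<subseteq> S \<and> length w = k. \<Sum>i\<in>S. F (w @ [i]))"
proof -
  have "(\<Sum>w | set w \<subseteq> S \<and> length w = k. \<Sum>i\<in>S. F (w @ [i])) =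
      (\<Sum>(w, i)\<in>{w. set w \<subseteq> S \<and> length w = k} \<times> S. F (w @ [i]))"
    by (rule sum.cartesian_product)
  also have "\<dots> = (\<Sum>w | set w \<subseteq> S \<and> length w = Suc k. F w)"
  proof (rule sum.reindex_bij_witness[of _ "\<lambda>w. (butlast w, last w)" "\<lambda>(w, i). w @ [i]"])
    fix w assume w: "w \<in> {w. set w \<subseteq> S \<and> length w = Suc k}"
    then have "w \<noteq> []" by auto
    then show "(case (butlast w, last w) of (w, i) \<Rightarrow> w @ [i]) = w"
      "(butlast w, last w) \<in> {w. set w \<subseteq> S \<and> length w = k} \<times> S"
      using w by (auto dest: in_set_butlastD)
  qed auto
  finally show ?thesis ..
qed

text \<open>The induction variable \<open>k\<close> counts expanded slots: those below
  \<open>k\<close> hold the bodies spelled by \<open>w\<close>, the others still hold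
  \<open>L\<close>. At \<open>k = CARD('n)\<close> the expansion is complete.\<close>

lemma mvol_expand_words:
  fixes K :: "nat \<Rightarrow> (real^'n::finite) set"
  assumes K: "\<And>i. i < N \<Longrightarrow> body_or_point (K i)" and c: "\<And>i. 0 \<le> c i"
    and L: "L = (\<Sum>i<N. (\<lambda>x. c i *\<^sub>R x) ` K i)"
  shows "k \<le> CARD('n) \<Longrightarrow> mvol (\<lambda>_. L) =
    (\<Sum>w | set w \<subseteq> {..<N} \<and> length w = k. prod_list (map c w) * mvol (\<lambda>j. if j < k then K (w ! j) else L))"
proof (induction k)
  case 0
  have "{w :: nat list. set w \<subseteq> {..<N} \<and> length w = 0} = {[]}" by auto
  then show ?case by simp
next
  case (Suc k)
  have bL: "body_or_point L"
    unfolding L by (intro body_or_point_sum body_or_point_scaleR K) auto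
  have step: "mvol (\<lambda>j. if j < k then K (w ! j) else L) =
      (\<Sum>i<N. c i * mvol (\<lambda>j. if j < Suc k then K ((w @ [i]) ! j) else L))"
    if w: "set w \<subseteq> {..<N}" "length w = k" for w
  proof -
    let ?A = "\<lambda>j. if j < k then K (w ! j) else L"
    have bA: "body_or_point (?A j)" for j
      using w bL by (auto intro!: K simp: subset_eq)
    have "mvol ?A = mvol (?A(k := L))"
      by (rule mvol_cong) auto
    also have "\<dots> = (\<Sum>i<N. c i * mvol (?A(k := K i)))"
      by (rule mvol_sum[of "{..<N}" k ?A K c, folded L]) (use Suc.prems K c in \<open>simp_all add: bA\<close>)
    also have "\<dots> = (\<Sum>i<N. c i * mvol (\<lambda>j. if j < Suc k then K ((w @ [i]) ! j) else L))"
      using w by (intro sum.cong refl arg_cong2[of _ _ _ _ "(*)"] mvol_cong) (auto simp: nth_append less_Suc_eq)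
    finally show ?thesis .
  qed
  have "mvol (\<lambda>_. L) = (\<Sum>w | set w \<subseteq> {..<N} \<and> length w = k.
      prod_list (map c w) * mvol (\<lambda>j. if j < k then K (w ! j) else L))"
    using Suc by simp
  also have "\<dots> = (\<Sum>w | set w \<subseteq> {..<N} \<and> length w = k.
      prod_list (map c w) * (\<Sum>i<N. c i * mvol (\<lambda>j. if j < Suc k then K ((w @ [i]) ! j) else L)))"
    by (intro sum.cong refl arg_cong2[of _ _ _ _ "(*)"] step) auto
  finally show ?case
    unfolding sum_words_Suc by (simp add: sum_distrib_left mult_ac)
qed

lemma prod_list_indicator:
  "prod_list (map (\<lambda>i. if i \<in> S then 1 else 0) w) = (if set w \<subseteq> S then 1 else (0::real))"
  by (induction w) auto

text \<open>Values at \<open>0/1\<close> vectors determine the coefficient of the word \<open>0 1 \<dots> n-1\<close>, by inclusion-exclusion.\<close>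

lemma squarefree_coefficient_unique:
  fixes M M' :: "nat multiset \<Rightarrow> real"
  assumes eq: "\<And>c. (\<And>i. 0 \<le> c i) \<Longrightarrow>
      (\<Sum>w | set w \<subseteq> {..<n} \<and> length w = n. prod_list (map c w) * M (mset w)) =
      (\<Sum>w | set w \<subseteq> {..<n} \<and> length w = n. prod_list (map c w) * M' (mset w))"
  shows "M (mset [0..<n]) = M' (mset [0..<n])"
proof -
  \<comment> \<open>Words that use every letter exactly once share one multiset, hence one
    coefficient; being nonzero, \<open>N\<close> can be cancelled at the end.\<close>
  define N where "N = card {w. set w = {..<n} \<and> length w = n}"
  have fin: "finite {w. set w \<subseteq> S \<and> length w = n}" if "finite S" for S :: "nat set"
    by (rule finite_lists_length_eq[OF that])
  have "finite {w. set w = {..<n} \<and> length w = n}"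
    by (rule finite_subset[OF _ fin[of "{..<n}"]]) auto
  moreover have "[0..<n] \<in> {w. set w = {..<n} \<and> length w = n}" by auto
  ultimately have "N \<noteq> 0" unfolding N_def by (metis card_eq_0_iff empty_iff)
  have coeff: "real N * X (mset [0..<n]) =
      (\<Sum>T\<in>Pow {..<n}. (-1) ^ (n - card T) * (\<Sum>w | set w \<subseteq> T \<and> length w = n. X (mset w)))"
    for X :: "nat multiset \<Rightarrow> real"
  proof -
    have word: "mset w = mset [0..<n]" if "set w = {..<n}" "length w = n" for w
    proof -
      have "distinct w" using that by (intro card_distinct) simp
      then show ?thesis
        by (subst set_eq_iff_mset_eq_distinct[symmetric]) (simp_all add: that atLeast0LessThan)
    qed
    have "real N * X (mset [0..<n]) = (\<Sum>w | set w = {..<n} \<and> length w = n. X (mset [0..<n]))"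
      by (simp add: N_def)
    also have "\<dots> = (\<Sum>w | set w = {..<n} \<and> length w = n. X (mset w))"
      by (intro sum.cong refl arg_cong[of _ _ X] word[symmetric]) simp_all
    also have "\<dots> = (\<Sum>T\<in>Pow {..<n}. (-1) ^ (card {..<n} - card T) * (\<Sum>w | set w \<subseteq> T \<and> length w = n. X (mset w)))"
    proof (rule inclusion_exclusion_mobius)
      fix S :: "nat set" assume S: "finite S"
      have "(\<Sum>w | set w \<subseteq> S \<and> length w = n. X (mset w)) =
         (\<Sum>T\<in>Pow S. \<Sum>w\<in>{w \<in> {w. set w \<subseteq> S \<and> length w = n}. set w = T}. X (mset w))"
        by (rule sum.group[symmetric]) (use S fin[OF S] in auto)
      also have "\<dots> = (\<Sum>T\<in>Pow S. \<Sum>w | set w = T \<and> length w = n. X (mset w))"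
        by (intro sum.cong) auto
      finally show "(\<Sum>w | set w \<subseteq> S \<and> length w = n. X (mset w)) =
         (\<Sum>T\<in>Pow S. \<Sum>w | set w = T \<and> length w = n. X (mset w))" .
    qed simp
    finally show ?thesis by simp
  qed
  have restrict: "(\<Sum>w | set w \<subseteq> {..<n} \<and> length w = n. prod_list (map (\<lambda>i. if i \<in> T then 1 else 0) w) * X (mset w)) =
      (\<Sum>w | set w \<subseteq> T \<and> length w = n. X (mset w))" if "T \<subseteq> {..<n}" for T and X :: "nat multiset \<Rightarrow> real"
  proof -
    have "(\<Sum>w | set w \<subseteq> {..<n} \<and> length w = n. prod_list (map (\<lambda>i. if i \<in> T then 1 else 0) w) * X (mset w)) =
       (\<Sum>w | set w \<subseteq> {..<n} \<and> length w = n. if w \<in> {w. set w \<subseteq> T} then X (mset w) else 0)"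
      unfolding prod_list_indicator by (intro sum.cong) auto
    also have "\<dots> = (\<Sum>w \<in> {w. set w \<subseteq> {..<n} \<and> length w = n} \<inter> {w. set w \<subseteq> T}. X (mset w))"
      by (rule sum.inter_restrict[symmetric]) (simp add: fin)
    also have "{w. set w \<subseteq> {..<n} \<and> length w = n} \<inter> {w. set w \<subseteq> T} = {w. set w \<subseteq> T \<and> length w = n}"
      using that by auto
    finally show ?thesis .
  qed
  have "(\<Sum>w | set w \<subseteq> T \<and> length w = n. M (mset w)) = (\<Sum>w | set w \<subseteq> T \<and> length w = n. M' (mset w))"
    if "T \<subseteq> {..<n}" for T
    using eq[of "\<lambda>i. if i \<in> T then 1 else 0"] restrict[OF that, of M] restrict[OF that, of M'] by simp
  then have "real N * M (mset [0..<n]) = real N * M' (mset [0..<n])"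
    unfolding coeff by (intro sum.cong) auto
  then show ?thesis using \<open>N \<noteq> 0\<close> by simp
qed

text \<open>The word expansion of \<open>mvol\<close> supplies a family of coefficients, and
  \<open>squarefree_coefficient_unique\<close> shows that every other family has the same value at
  the word in question.\<close>

proposition mixed_volume_eq_mvol:
  fixes Ks :: "(real^'n::finite) set list"
  assumes K: "\<And>i. i < CARD('n) \<Longrightarrow> body_or_point (Ks ! i)"
  shows "mixed_volume Ks = mvol (\<lambda>i. Ks ! i)"
proof -
  let ?n = "CARD('n)"
  \<comment> \<open>The sorted word represents its multiset; by symmetry of \<open>mvol\<close>,
    every word with that multiset gives the same value.\<close>
  define M where "M \<mu> = mvol (\<lambda>j. Ks ! (sorted_list_of_multiset \<mu> ! j))" for \<mu>
  have M_word: "M (mset w) = mvol (\<lambda>j. Ks ! (w ! j))" if w: "length w = ?n" for w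
  proof -
    let ?s = "sorted_list_of_multiset (mset w)"
    have "mset ?s = mset w" by simp
    then obtain p where p: "p permutes {..<length w}" "permute_list p w = ?s"
      by (rule mset_eq_permutation)
    have "M (mset w) = mvol (\<lambda>j. Ks ! (w ! p j))"
      unfolding M_def p(2)[symmetric] using p(1) w
      by (intro mvol_cong) (simp add: permute_list_nth)
    also have "\<dots> = mvol (\<lambda>j. Ks ! (w ! j))"
      using mvol_permute[of p "\<lambda>j. Ks ! (w ! j)"] p(1) w by simp
    finally show ?thesis .
  qed
  have expand: "measure lebesgue (\<Sum>i<?n. (\<lambda>x. c i *\<^sub>R x) ` (Ks ! i)) =
      (\<Sum>w | set w \<subseteq> {..<?n} \<and> length w = ?n. prod_list (map c w) * M (mset w))"
    if c: "\<forall>i. 0 \<le> c i" for c :: "nat \<Rightarrow> real"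
  proof -
    define L where "L = (\<Sum>i<?n. (\<lambda>x. c i *\<^sub>R x) ` (Ks ! i))"
    have "body_or_point L"
      unfolding L_def by (intro body_or_point_sum body_or_point_scaleR K) auto
    then have "measure lebesgue L = mvol (\<lambda>_. L)" by (rule mvol_const[symmetric])
    also have "\<dots> = (\<Sum>w | set w \<subseteq> {..<?n} \<and> length w = ?n.
        prod_list (map c w) * mvol (\<lambda>j. if j < ?n then Ks ! (w ! j) else L))"
      by (rule mvol_expand_words[OF K _ L_def]) (use c in auto)
    also have "\<dots> = (\<Sum>w | set w \<subseteq> {..<?n} \<and> length w = ?n. prod_list (map c w) * M (mset w))"
      by (intro sum.cong refl arg_cong2[of _ _ _ _ "(*)"]) (auto simp: M_word intro!: mvol_cong)
    finally show ?thesis by (simp add: L_def)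
  qed
  have M_id: "M (mset [0..<?n]) = mvol (\<lambda>i. Ks ! i)"
    by (subst M_word) (auto intro!: mvol_cong)
  show ?thesis
    unfolding mixed_volume_def
  proof (intro the_equality exI conjI)
    show "\<forall>c. (\<forall>i. 0 \<le> c i) \<longrightarrow>
        measure lebesgue (\<Sum>i<?n. (\<lambda>x. c i *\<^sub>R x) ` (Ks ! i)) =
        (\<Sum>w | set w \<subseteq> {..<?n} \<and> length w = ?n. prod_list (map c w) * M (mset w))"
      using expand by blast
    show "mvol (\<lambda>i. Ks ! i) = M (mset [0..<?n])"
      by (rule M_id[symmetric])
  next
    fix v assume "\<exists>M'. (\<forall>c. (\<forall>i. 0 \<le> c i) \<longrightarrow>
        measure lebesgue (\<Sum>i<?n. (\<lambda>x. c i *\<^sub>R x) ` (Ks ! i)) =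
        (\<Sum>w | set w \<subseteq> {..<?n} \<and> length w = ?n. prod_list (map c w) * M' (mset w))) \<and>
        v = M' (mset [0..<?n])"
    then obtain M' where M': "\<And>c. (\<And>i. 0 \<le> c i) \<Longrightarrow>
        measure lebesgue (\<Sum>i<?n. (\<lambda>x. c i *\<^sub>R x) ` (Ks ! i)) =
        (\<Sum>w | set w \<subseteq> {..<?n} \<and> length w = ?n. prod_list (map c w) * M' (mset w))"
      "v = M' (mset [0..<?n])" by blast
    have "M' (mset [0..<?n]) = M (mset [0..<?n])"
    proof (rule squarefree_coefficient_unique)
      fix c :: "nat \<Rightarrow> real" assume c: "\<And>i. 0 \<le> c i"
      show "(\<Sum>w | set w \<subseteq> {..<?n} \<and> length w = ?n. prod_list (map c w) * M' (mset w)) =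
          (\<Sum>w | set w \<subseteq> {..<?n} \<and> length w = ?n. prod_list (map c w) * M (mset w))"
        by (rule trans[OF M'(1)[OF c, symmetric] expand]) (simp add: c)
    qed
    then show "v = mvol (\<lambda>i. Ks ! i)"
      using M'(2) M_id by (simp only:)
  qed
qed

subsection \<open>Mixed volumes of differences of support functions\<close>

lemma support_function_eq:
  assumes "y \<in> K" "\<And>x. x \<in> K \<Longrightarrow> x \<bullet> u \<le> y \<bullet> u"
  shows "support_function K u = y \<bullet> u"
  unfolding support_function_def using assms by (intro cSup_eq_maximum) auto

lemma support_function_attained:
  assumes "compact K" "K \<noteq> {}"
  obtains y where "y \<in> K" "\<And>x. x \<in> K \<Longrightarrow> x \<bullet> u \<le> y \<bullet> u" "support_function K u = y \<bullet> u"
proof -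
  have "continuous_on K (\<lambda>x. x \<bullet> u)" by (intro continuous_intros)
  then obtain y where "y \<in> K" "\<And>x. x \<in> K \<Longrightarrow> x \<bullet> u \<le> y \<bullet> u"
    using continuous_attains_sup[OF assms] by metis
  then show ?thesis using that support_function_eq by blast
qed

lemma convex_bodyD:
  assumes "convex_body K"
  shows "compact K" "convex K" "K \<noteq> {}" "closed K"
  using assms interior_subset[of K] by (auto simp: convex_body_def compact_imp_closed)

lemma support_function_plus:
  assumes "convex_body K" "convex_body L"
  shows "support_function (K + L) u = support_function K u + support_function L u"
proof -
  obtain y where y: "y \<in> K" "\<And>x. x \<in> K \<Longrightarrow> x \<bullet> u \<le> y \<bullet> u" "support_function K u = y \<bullet> u"
    using support_function_attained convex_bodyD[OF assms(1)] by metis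
  obtain z where z: "z \<in> L" "\<And>x. x \<in> L \<Longrightarrow> x \<bullet> u \<le> z \<bullet> u" "support_function L u = z \<bullet> u"
    using support_function_attained convex_bodyD[OF assms(2)] by metis
  have "support_function (K + L) u = (y + z) \<bullet> u"
    by (rule support_function_eq)
      (use y(1,2) z(1,2) in \<open>auto elim!: set_plus_elim simp: inner_add_left intro!: add_mono\<close>)
  then show ?thesis using y(3) z(3) by (simp add: inner_add_left)
qed

lemma support_function_scaleR:
  assumes "convex_body K" "c \<ge> 0"
  shows "support_function ((\<lambda>x. c *\<^sub>R x) ` K) u = c * support_function K u"
proof -
  obtain y where y: "y \<in> K" "\<And>x. x \<in> K \<Longrightarrow> x \<bullet> u \<le> y \<bullet> u" "support_function K u = y \<bullet> u"
    using support_function_attained convex_bodyD[OF assms(1)] by metis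
  have "support_function ((\<lambda>x. c *\<^sub>R x) ` K) u = (c *\<^sub>R y) \<bullet> u"
    by (rule support_function_eq) (use y(1,2) assms(2) in \<open>auto intro!: mult_left_mono\<close>)
  then show ?thesis using y(3) by simp
qed

lemma support_function_uminus: "support_function (uminus ` K) u = support_function K (- u)"
  by (simp add: support_function_def image_image)

lemma support_function_cball:
  assumes "u \<in> sphere 0 1" shows "support_function (cball 0 1) u = 1"
proof -
  have "support_function (cball 0 1) u = u \<bullet> u"
  proof (rule support_function_eq)
    fix x assume "x \<in> cball (0 :: real^'a) 1"
    then have "x \<bullet> u \<le> 1"
      using norm_cauchy_schwarz[of x u] assms by simp
    then show "x \<bullet> u \<le> u \<bullet> u" using assms by (simp add: dot_square_norm)
  qed (use assms in auto)
  then show ?thesis using assms by (simp add: dot_square_norm)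
qed

lemma convex_body_cball: "convex_body (cball 0 1 :: (real^'n::finite) set)"
  by (simp add: convex_body_def interior_cball)

text \<open>A point of \<open>K\<close> outside \<open>L\<close> is separated from \<open>L\<close>
  by a functional that is larger on \<open>L\<close>; its negative, normalized, is a direction in
  which the support function of \<open>K\<close> exceeds that of \<open>L\<close>.\<close>

lemma support_function_le_imp_subset:
  assumes K: "convex_body K" and L: "convex_body L"
    and le: "\<And>u. u \<in> sphere 0 1 \<Longrightarrow> support_function K u \<le> support_function L u"
  shows "K \<subseteq> L"
proof
  fix x assume x: "x \<in> K"
  show "x \<in> L"
  proof (rule ccontr)
    assume "x \<notin> L"
    then obtain a b where ab: "a \<bullet> x < b" "\<And>y. y \<in> L \<Longrightarrow> a \<bullet> y > b"
      using separating_hyperplane_closed_point[of L x] convex_bodyD[OF L] by metis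
    have "a \<noteq> 0" using ab convex_bodyD(3)[OF L] by fastforce
    define u where "u = - (a /\<^sub>R norm a)"
    have u: "u \<in> sphere 0 1" using \<open>a \<noteq> 0\<close> by (simp add: u_def)
    have in_u: "z \<bullet> u = - (a \<bullet> z) / norm a" for z
      by (simp add: u_def inner_commute divide_inverse)
    obtain y where y: "\<And>x. x \<in> K \<Longrightarrow> x \<bullet> u \<le> y \<bullet> u" "support_function K u = y \<bullet> u"
      using support_function_attained convex_bodyD[OF K] by metis
    obtain z where z: "z \<in> L" "support_function L u = z \<bullet> u"
      using support_function_attained convex_bodyD[OF L] by metis
    have "x \<bullet> u \<le> z \<bullet> u" using y(1)[OF x] y(2) z(2) le[OF u] by simp
    then have "a \<bullet> z \<le> a \<bullet> x"
      using \<open>a \<noteq> 0\<close> by (simp add: in_u divide_le_cancel)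
    then show False using ab(1) ab(2)[OF z(1)] by simp
  qed
qed

lemma support_function_inject:
  assumes "convex_body K" "convex_body L"
    and "\<And>u. u \<in> sphere 0 1 \<Longrightarrow> support_function K u = support_function L u"
  shows "K = L"
  using support_function_le_imp_subset[OF assms(1,2)] support_function_le_imp_subset[OF assms(2,1)] assms(3)
  by auto

text \<open>The signed sum of \<open>mixed_volume_fun\<close>, with \<open>mvol\<close> in place of
  \<open>mixed_volume\<close> so that \<open>{0}\<close> is a legitimate entry. If
  \<open>L i = {0}\<close>, only the terms whose index set avoids \<open>i\<close> survive.\<close>

definition mvol_diff :: "(nat \<Rightarrow> (real^'n::finite) set) \<Rightarrow> (nat \<Rightarrow> (real^'n) set) \<Rightarrow> real" where
  "mvol_diff K L = (\<Sum>I\<in>Pow {..<CARD('n)}. (-1) ^ card I * mvol (\<lambda>i. if i \<in> I then L i else K i))"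

text \<open>Pairing \<open>I\<close> with \<open>insert k I\<close> exhibits slot \<open>k\<close>
  as a difference of its two entries, ready for additivity in that slot.\<close>

lemma mvol_diff_split:
  fixes K L :: "nat \<Rightarrow> (real^'n::finite) set"
  assumes k: "k < CARD('n)"
  shows "mvol_diff K L = (\<Sum>I\<in>Pow ({..<CARD('n)} - {k}). (-1) ^ card I *
    (mvol ((\<lambda>i. if i \<in> I then L i else K i)(k := K k)) - mvol ((\<lambda>i. if i \<in> I then L i else K i)(k := L k))))"
proof -
  have ins: "insert k ({..<CARD('n)} - {k}) = {..<CARD('n)}" using k by auto
  have eq1: "(\<lambda>i. if i \<in> I then L i else K i)(k := K k) = (\<lambda>i. if i \<in> I then L i else K i)"
    and eq2: "(\<lambda>i. if i \<in> I then L i else K i)(k := L k) = (\<lambda>i. if i \<in> insert k I then L i else K i)"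
    and card: "card (insert k I) = Suc (card I)"
    if "I \<in> Pow ({..<CARD('n)} - {k})" for I
    using that finite_subset[of I "{..<CARD('n)} - {k}"] by (auto simp: fun_eq_iff subset_eq)
  have "mvol_diff K L = (\<Sum>I\<in>Pow ({..<CARD('n)} - {k}).
      (-1) ^ card I * mvol (\<lambda>i. if i \<in> I then L i else K i) +
      (-1) ^ card (insert k I) * mvol (\<lambda>i. if i \<in> insert k I then L i else K i))"
    unfolding mvol_diff_def by (subst ins[symmetric], rule sum_Pow_insert) auto
  also have "\<dots> = (\<Sum>I\<in>Pow ({..<CARD('n)} - {k}). (-1) ^ card I *
    (mvol ((\<lambda>i. if i \<in> I then L i else K i)(k := K k)) - mvol ((\<lambda>i. if i \<in> I then L i else K i)(k := L k))))"
    by (rule sum.cong[OF refl], simp only: eq1 eq2 card) (simp add: algebra_simps)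
  finally show ?thesis .
qed

text \<open>The hypothesis \<open>K k + Y = X + L k\<close> says that \<open>X, Y\<close> represent the same difference of support
  functions as \<open>K k, L k\<close>.\<close>

lemma mvol_diff_exchange_slot:
  fixes K L :: "nat \<Rightarrow> (real^'n::finite) set"
  assumes k: "k < CARD('n)"
    and bodies: "\<And>i. i < CARD('n) \<Longrightarrow> body_or_point (K i)" "\<And>i. i < CARD('n) \<Longrightarrow> body_or_point (L i)"
    and X: "body_or_point X" and Y: "body_or_point Y" and eq: "K k + Y = X + L k"
  shows "mvol_diff (K(k := X)) (L(k := Y)) = mvol_diff K L"
  unfolding mvol_diff_split[OF k]
proof (intro sum.cong refl arg_cong2[of _ _ _ _ "(*)"])
  fix I assume "I \<in> Pow ({..<CARD('n)} - {k})"
  then have "k \<notin> I" by auto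
  define A where "A = (\<lambda>i. if i \<in> I then L i else K i)"
  have A: "body_or_point (A i)" if "i < CARD('n)" "i \<noteq> k" for i
    using bodies that by (simp add: A_def)
  have upd: "(\<lambda>i. if i \<in> I then (L(k := Y)) i else (K(k := X)) i)(k := Z) = A(k := Z)" for Z
    by (auto simp: A_def fun_eq_iff)
  have "mvol (A(k := K k)) + mvol (A(k := Y)) = mvol (A(k := X)) + mvol (A(k := L k))"
    using mvol_add[of k A "K k" Y] mvol_add[of k A X "L k"] A bodies[OF k] X Y k eq by simp
  then show "mvol ((\<lambda>i. if i \<in> I then (L(k := Y)) i else (K(k := X)) i)(k := (K(k := X)) k)) -
      mvol ((\<lambda>i. if i \<in> I then (L(k := Y)) i else (K(k := X)) i)(k := (L(k := Y)) k)) =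
      mvol ((\<lambda>i. if i \<in> I then L i else K i)(k := K k)) - mvol ((\<lambda>i. if i \<in> I then L i else K i)(k := L k))"
    unfolding upd by (simp add: A_def[symmetric])
qed

lemma mvol_diff_cong:
  fixes K L :: "nat \<Rightarrow> (real^'n::finite) set"
  assumes "\<And>i. i < CARD('n) \<Longrightarrow> K i = K' i" "\<And>i. i < CARD('n) \<Longrightarrow> L i = L' i"
  shows "mvol_diff K L = mvol_diff K' L'"
  unfolding mvol_diff_def
  by (intro sum.cong refl arg_cong2[of _ _ _ _ "(*)"] mvol_cong) (use assms in auto)

lemma mvol_diff_exchange:
  fixes K L :: "nat \<Rightarrow> (real^'n::finite) set"
  assumes "\<And>i. i < CARD('n) \<Longrightarrow> body_or_point (K i)" "\<And>i. i < CARD('n) \<Longrightarrow> body_or_point (L i)"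
    and "\<And>i. i < CARD('n) \<Longrightarrow> body_or_point (K' i)" "\<And>i. i < CARD('n) \<Longrightarrow> body_or_point (L' i)"
    and eq: "\<And>i. i < CARD('n) \<Longrightarrow> K i + L' i = K' i + L i"
  shows "mvol_diff K L = mvol_diff K' L'"
proof -
  have "mvol_diff (\<lambda>i. if i < k then K' i else K i) (\<lambda>i. if i < k then L' i else L i) = mvol_diff K L"
    if "k \<le> CARD('n)" for k
    using that
  proof (induction k)
    case (Suc k)
    have upd: "(\<lambda>i. if i < Suc k then X i else Y i) = (\<lambda>i. if i < k then X i else Y i)(k := X k)"
      for X Y :: "nat \<Rightarrow> (real^'n) set"
      by (auto simp: fun_eq_iff less_Suc_eq)
    show ?case
      unfolding upd using Suc assms by (subst mvol_diff_exchange_slot) auto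
  qed simp
  then have "mvol_diff K L = mvol_diff (\<lambda>i. if i < CARD('n) then K' i else K i) (\<lambda>i. if i < CARD('n) then L' i else L i)"
    by simp
  also have "\<dots> = mvol_diff K' L'"
    by (rule mvol_diff_cong) auto
  finally show ?thesis .
qed

text \<open>Two representations of the same functions satisfy
  \<open>Ks ! i + L i = K i + Ls ! i\<close>, since these convex bodies have equal support functions
  on the sphere. By \<open>mvol_diff_exchange\<close> both give the same value, so the description
  is definite.\<close>

proposition mixed_volume_fun_eq_mvol_diff:
  fixes fs :: "(real^'n::finite \<Rightarrow> real) list"
  assumes K: "\<And>i. i < CARD('n) \<Longrightarrow> convex_body (K i)" and L: "\<And>i. i < CARD('n) \<Longrightarrow> convex_body (L i)"
    and f: "\<And>i u. i < CARD('n) \<Longrightarrow> u \<in> sphere 0 1 \<Longrightarrow>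
      (fs ! i) u = support_function (K i) u - support_function (L i) u"
  shows "mixed_volume_fun fs = mvol_diff K L"
proof -
  have expand: "(\<Sum>I\<in>Pow {..<CARD('n)}. (-1) ^ card I *
      mixed_volume (map (\<lambda>i. if i \<in> I then Ls ! i else Ks ! i) [0..<CARD('n)])) =
      mvol_diff (\<lambda>i. Ks ! i) (\<lambda>i. Ls ! i)"
    if "\<And>i. i < CARD('n) \<Longrightarrow> convex_body (Ks ! i)" "\<And>i. i < CARD('n) \<Longrightarrow> convex_body (Ls ! i)"
    for Ks Ls :: "(real^'n) set list"
    unfolding mvol_diff_def
    by (intro sum.cong refl arg_cong2[of _ _ _ _ "(*)"])
      (subst mixed_volume_eq_mvol; use that in \<open>auto intro!: mvol_cong\<close>)
  show ?thesis
    unfolding mixed_volume_fun_def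
  proof (rule the_equality, intro exI conjI)
    let ?Ks = "map K [0..<CARD('n)]" and ?Ls = "map L [0..<CARD('n)]"
    show "\<forall>i<CARD('n). convex_body (?Ks ! i) \<and> convex_body (?Ls ! i) \<and>
        (\<forall>u\<in>sphere 0 1. (fs ! i) u = support_function (?Ks ! i) u - support_function (?Ls ! i) u)"
      using K L f by simp
    show "mvol_diff K L = (\<Sum>I\<in>Pow {..<CARD('n)}. (-1) ^ card I *
        mixed_volume (map (\<lambda>i. if i \<in> I then ?Ls ! i else ?Ks ! i) [0..<CARD('n)]))"
      by (subst expand) (use K L in \<open>auto intro!: mvol_diff_cong\<close>)
  next
    fix v assume "\<exists>Ks Ls. length Ks = CARD('n) \<and> length Ls = CARD('n) \<and>
       (\<forall>i<CARD('n). convex_body (Ks ! i) \<and> convex_body (Ls ! i) \<and>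
        (\<forall>u\<in>sphere 0 1. (fs ! i) u = support_function (Ks ! i) u - support_function (Ls ! i) u)) \<and>
       v = (\<Sum>I\<in>Pow {..<CARD('n)}. (-1) ^ card I *
            mixed_volume (map (\<lambda>i. if i \<in> I then Ls ! i else Ks ! i) [0..<CARD('n)]))"
    then obtain Ks Ls where Ks: "\<And>i. i < CARD('n) \<Longrightarrow> convex_body (Ks ! i)"
      and Ls: "\<And>i. i < CARD('n) \<Longrightarrow> convex_body (Ls ! i)"
      and fs: "\<And>i u. i < CARD('n) \<Longrightarrow> u \<in> sphere 0 1 \<Longrightarrow>
        (fs ! i) u = support_function (Ks ! i) u - support_function (Ls ! i) u"
      and v: "v = (\<Sum>I\<in>Pow {..<CARD('n)}. (-1) ^ card I *
            mixed_volume (map (\<lambda>i. if i \<in> I then Ls ! i else Ks ! i) [0..<CARD('n)]))"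
      by blast
    have "Ks ! i + L i = K i + Ls ! i" if i: "i < CARD('n)" for i
    proof (rule support_function_inject)
      fix u :: "real^'n" assume u: "u \<in> sphere 0 1"
      show "support_function (Ks ! i + L i) u = support_function (K i + Ls ! i) u"
        using f[OF i u] fs[OF i u] by (simp add: support_function_plus Ks Ls K L i)
    qed (simp_all add: convex_body_plus Ks Ls K L i)
    then show "v = mvol_diff K L"
      unfolding v by (subst expand) (auto intro!: mvol_diff_exchange simp: Ks Ls K L)
  qed simp_all
qed

subsection \<open>Bodies of constant width\<close>

text \<open>Used with \<open>mvol_permute\<close> to move a chosen set of slots to the front, so
  that only its cardinality matters.\<close>

lemma ex_permutes_onto_initial:
  assumes I: "I \<subseteq> {..<m::nat}"
  obtains p where "p permutes {..<m}" "\<And>i. i < m \<Longrightarrow> p i < card I \<longleftrightarrow> i \<in> I"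
proof -
  have fin: "finite I" using I finite_subset by blast
  have le: "card I \<le> m" using card_mono[OF _ I] by simp
  have "card I = card {..<card I}" "card ({..<m} - I) = card {card I..<m}"
    using I fin by (simp_all add: card_Diff_subset)
  then obtain g h where g: "bij_betw g I {..<card I}" and h: "bij_betw h ({..<m} - I) {card I..<m}"
    using finite_same_card_bij[OF fin finite_lessThan] finite_same_card_bij[of "{..<m} - I" "{card I..<m}"]
    by (metis finite_Diff finite_atLeastLessThan finite_lessThan)
  define p where "p i = (if i \<in> I then g i else if i < m then h i else i)" for i
  have "bij_betw p I {..<card I}"
    using g by (subst bij_betw_cong[of _ _ g]) (auto simp: p_def)
  moreover have "bij_betw p ({..<m} - I) {card I..<m}"
    using h by (subst bij_betw_cong[of _ _ h]) (auto simp: p_def)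
  ultimately have "bij_betw p (I \<union> ({..<m} - I)) ({..<card I} \<union> {card I..<m})"
    by (rule bij_betw_combine) auto
  moreover have "I \<union> ({..<m} - I) = {..<m}" "{..<card I} \<union> {card I..<m} = {..<m}"
    using I le by auto
  ultimately have bij: "bij_betw p {..<m} {..<m}" by simp
  have "p permutes {..<m}"
    by (rule bij_imp_permutes[OF bij]) (use I in \<open>auto simp: p_def\<close>)
  moreover have "p i < card I \<longleftrightarrow> i \<in> I" if "i < m" for i
    using bij_betwE[OF g] bij_betwE[OF h] that
    by (cases "i \<in> I") (auto simp: p_def dest!: bspec[of _ _ i])
  ultimately show ?thesis by (rule that)
qed

lemma mvol_scaleR_slots:
  fixes A :: "nat \<Rightarrow> (real^'n::finite) set"
  assumes "finite J" "J \<subseteq> {..<CARD('n)}" and X: "body_or_point X" and r: "r \<ge> 0"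
    and "\<And>i. body_or_point (A i)"
  shows "mvol (\<lambda>i. if i \<in> J then (\<lambda>x. r *\<^sub>R x) ` X else A i) = r ^ card J * mvol (\<lambda>i. if i \<in> J then X else A i)"
  using assms(1,2,5)
proof (induction J arbitrary: A rule: finite_induct)
  case (insert k J)
  let ?Y = "(\<lambda>x. r *\<^sub>R x) ` X"
  have "mvol (\<lambda>i. if i \<in> insert k J then ?Y else A i) = mvol ((\<lambda>i. if i \<in> J then ?Y else A i)(k := ?Y))"
    by (rule mvol_cong) auto
  also have "\<dots> = r * mvol ((\<lambda>i. if i \<in> J then ?Y else A i)(k := X))"
    by (rule mvol_scaleR) (use insert.prems X r body_or_point_scaleR[OF X] in auto)
  \<comment> \<open>The unscaled \<open>X\<close> in slot \<open>k\<close> is absorbed into the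
    background family; this is why the induction generalizes over \<open>A\<close>.\<close>
  also have "mvol ((\<lambda>i. if i \<in> J then ?Y else A i)(k := X)) = mvol (\<lambda>i. if i \<in> J then ?Y else (A(k := X)) i)"
    using insert.hyps by (intro mvol_cong) auto
  also have "\<dots> = r ^ card J * mvol (\<lambda>i. if i \<in> J then X else (A(k := X)) i)"
    using insert.prems X by (intro insert.IH) auto
  also have "mvol (\<lambda>i. if i \<in> J then X else (A(k := X)) i) = mvol (\<lambda>i. if i \<in> insert k J then X else A i)"
    by (rule mvol_cong) auto
  finally show ?case using insert.hyps by simp
qed simp

lemma sum_Pow_card:
  fixes F :: "nat \<Rightarrow> real"
  shows "(\<Sum>I\<in>Pow {..<m::nat}. F (card I)) = (\<Sum>k\<le>m. real (m choose k) * F k)"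
proof -
  have "(\<Sum>I\<in>Pow {..<m}. F (card I)) = (\<Sum>k\<le>m. \<Sum>I\<in>{I \<in> Pow {..<m}. card I = k}. F (card I))"
    by (rule sum.group[symmetric]) (auto intro: order_trans[OF card_mono[OF finite_lessThan]])
  also have "\<dots> = (\<Sum>k\<le>m. real (m choose k) * F k)"
    by (intro sum.cong refl) (simp add: n_subsets)
  finally show ?thesis .
qed

lemma set_plus_singleton_zero: "K + {0 :: 'a::comm_monoid_add} = K"
  unfolding set_zero[symmetric] by (rule add_0_right)

lemma mixed_Q_eq_sum:
  fixes K L :: "(real^'n::finite) set"
  assumes K: "convex_body K" and L: "convex_body L" and m: "m \<le> CARD('n)"
    and f: "\<And>u. u \<in> sphere 0 1 \<Longrightarrow> f u = support_function K u - support_function L u"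
  shows "mixed_Q m f = (\<Sum>k\<le>m. real (m choose k) * (-1) ^ k *
    mvol (\<lambda>i. if i < k then L else if i < m then K else (cball 0 1 :: (real^'n) set)))"
proof -
  let ?B = "cball 0 1 :: (real^'n) set"
  let ?A = "\<lambda>I i. if i \<in> I then (if i < m then L else {0}) else if i < m then K else ?B"
  note B = convex_body_cball[where 'n = 'n]
  \<comment> \<open>\<open>mixed_volume_fun\<close> accepts only convex bodies, so the function 1
    enters as the difference for \<open>?B + ?B\<close> and \<open>?B\<close>. The next step
    exchanges this pair for \<open>?B\<close> and \<open>{0}\<close>.\<close>
  have "mixed_Q m f = mvol_diff (\<lambda>i. if i < m then K else ?B + ?B) (\<lambda>i. if i < m then L else ?B)"
    unfolding mixed_Q_def
    by (rule mixed_volume_fun_eq_mvol_diff)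
      (use m in \<open>auto simp: K L B convex_body_plus nth_append f support_function_plus support_function_cball\<close>)
  also have "\<dots> = mvol_diff (\<lambda>i. if i < m then K else ?B) (\<lambda>i. if i < m then L else {0})"
    by (rule mvol_diff_exchange) (simp_all add: K L B convex_body_plus set_plus_singleton_zero)
  also have "\<dots> = (\<Sum>I\<in>Pow {..<CARD('n)}. (-1) ^ card I * mvol (?A I))"
    by (simp add: mvol_diff_def)
  \<comment> \<open>An index set reaching beyond the first \<open>m\<close> slots puts
    \<open>{0}\<close> into one of them, so its term vanishes.\<close>
  also have "\<dots> = (\<Sum>I\<in>Pow {..<m}. (-1) ^ card I * mvol (?A I))"
  proof (rule sum.mono_neutral_right)
    show "\<forall>I\<in>Pow {..<CARD('n)} - Pow {..<m}. (-1) ^ card I * mvol (?A I) = 0"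
    proof
      fix I assume "I \<in> Pow {..<CARD('n)} - Pow {..<m}"
      then obtain i where "i \<in> I" "i < CARD('n)" "\<not> i < m" by auto
      then have "mvol (?A I) = 0" by (intro mvol_zero[of i]) auto
      then show "(-1) ^ card I * mvol (?A I) = 0" by simp
    qed
  qed (use m in auto)
  also have "\<dots> = (\<Sum>I\<in>Pow {..<m}. (-1) ^ card I * mvol (\<lambda>i. if i < card I then L else if i < m then K else ?B))"
  proof (intro sum.cong refl arg_cong2[of _ _ _ _ "(*)"])
    fix I assume I: "I \<in> Pow {..<m}"
    then obtain p where p: "p permutes {..<m}" "\<And>i. i < m \<Longrightarrow> p i < card I \<longleftrightarrow> i \<in> I"
      using ex_permutes_onto_initial by blast
    have card: "card I \<le> m" using I card_mono[of "{..<m}" I] by simp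
    have pm: "p i < m \<longleftrightarrow> i < m" for i
      using permutes_in_image[OF p(1), of i] by simp
    have "mvol (?A I) = mvol (\<lambda>i. (\<lambda>i. if i < card I then L else if i < m then K else ?B) (p i))"
    proof (rule mvol_cong)
      fix i
      show "?A I i = (if p i < card I then L else if p i < m then K else ?B)"
        using p(2)[of i] pm[of i] card I by (cases "i < m") auto
    qed
    also have "\<dots> = mvol (\<lambda>i. if i < card I then L else if i < m then K else ?B)"
      by (rule mvol_permute) (use p(1) m in \<open>auto intro: permutes_subset\<close>)
    finally show "mvol (?A I) = mvol (\<lambda>i. if i < card I then L else if i < m then K else ?B)" .
  qed
  also have "\<dots> = (\<Sum>k\<le>m. real (m choose k) * ((-1) ^ k * mvol (\<lambda>i. if i < k then L else if i < m then K else ?B)))"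
    by (rule sum_Pow_card)
  finally show ?thesis by (simp add: mult.assoc)
qed

lemma quermassintegral_eq_mvol:
  fixes K :: "(real^'n::finite) set"
  assumes "convex_body K" "j \<le> CARD('n)"
  shows "quermassintegral j K = mvol (\<lambda>i. if i < CARD('n) - j then K else (cball 0 1 :: (real^'n) set))"
  unfolding quermassintegral_def using assms convex_body_cball[where 'n = 'n]
  by (subst mixed_volume_eq_mvol) (auto simp: nth_append intro!: mvol_cong)

text \<open>On the sphere \<open>h\<close> is the difference of the support functions of
  \<open>K\<close> and of the ball of radius \<open>r\<close>; every slot in which the ball is
  chosen contributes a factor \<open>- r\<close>.\<close>

lemma mixed_Q_constant_width:
  fixes K :: "(real^'n::finite) set"
  assumes K: "convex_body K" and r: "r > 0" and m: "m \<le> CARD('n)"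
    and h: "\<And>u. u \<in> sphere 0 1 \<Longrightarrow> support_function K u = r + h u"
  shows "mixed_Q m h = (\<Sum>k\<le>m. real (m choose k) * (- r) ^ (m - k) *
    mvol (\<lambda>i. if i < k then K else (cball 0 1 :: (real^'n) set)))"
proof -
  let ?B = "cball 0 1 :: (real^'n) set"
  let ?rB = "(\<lambda>x. r *\<^sub>R x) ` ?B"
  note B = convex_body_cball[where 'n = 'n]
  have rB: "convex_body ?rB" using convex_body_scaleR[OF B] r by simp
  have slots: "mvol (\<lambda>i. if i < k then ?rB else if i < m then K else ?B) =
      r ^ k * mvol (\<lambda>i. if i < m - k then K else ?B)" if "k \<le> m" for k
  proof -
    have "mvol (\<lambda>i. if i < k then ?rB else if i < m then K else ?B) =
        mvol (\<lambda>i. if i \<in> {..<k} then ?rB else if i < m then K else ?B)"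
      by simp
    also have "\<dots> = r ^ k * mvol (\<lambda>i. if i \<in> {..<k} then ?B else if i < m then K else ?B)"
      using that m r by (subst mvol_scaleR_slots) (auto simp: K B)
    also have "mvol (\<lambda>i. if i \<in> {..<k} then ?B else if i < m then K else ?B) = mvol (\<lambda>i. if i < m - k then K else ?B)"
    proof -
      have sub: "{k..<m} \<subseteq> {..<CARD('n)}" using m by auto
      obtain p where p: "p permutes {..<CARD('n)}" "\<And>i. i < CARD('n) \<Longrightarrow> p i < card {k..<m} \<longleftrightarrow> i \<in> {k..<m}"
        using ex_permutes_onto_initial[OF sub] by blast
      \<comment> \<open>The copies of \<open>K\<close>, in slots \<open>k\<close> to
        \<open>m - 1\<close>, are moved to the front.\<close>
      have "mvol (\<lambda>i. if i \<in> {..<k} then ?B else if i < m then K else ?B) =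
          mvol (\<lambda>i. (\<lambda>i. if i < m - k then K else ?B) (p i))"
        by (rule mvol_cong) (use p(2) in auto)
      also have "\<dots> = mvol (\<lambda>i. if i < m - k then K else ?B)"
        by (rule mvol_permute[OF p(1)])
      finally show ?thesis .
    qed
    finally show ?thesis .
  qed
  have "mixed_Q m h = (\<Sum>k\<le>m. real (m choose k) * (-1) ^ k * mvol (\<lambda>i. if i < k then ?rB else if i < m then K else ?B))"
    by (rule mixed_Q_eq_sum[OF K rB m])
      (use h r in \<open>simp add: support_function_scaleR[OF B] support_function_cball\<close>)
  also have "\<dots> = (\<Sum>k\<le>m. real (m choose k) * (- r) ^ k * mvol (\<lambda>i. if i < m - k then K else ?B))"
    by (intro sum.cong refl) (simp add: slots power_minus[of r] mult_ac)
  \<comment> \<open>Reversing the sum makes the index count copies of \<open>K\<close> instead of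
    balls.\<close>
  also have "\<dots> = (\<Sum>k\<le>m. real (m choose (m - k)) * (- r) ^ (m - k) * mvol (\<lambda>i. if i < m - (m - k) then K else ?B))"
    by (rule sum.nat_diff_reindex[symmetric, of _ "Suc m", unfolded lessThan_Suc_atMost diff_Suc_Suc diff_zero])
  also have "\<dots> = (\<Sum>k\<le>m. real (m choose k) * (- r) ^ (m - k) * mvol (\<lambda>i. if i < k then K else ?B))"
    by (intro sum.cong refl) (auto simp: binomial_symmetric[symmetric])
  finally show ?thesis .
qed

text \<open>Reflecting \<open>K\<close> in the origin changes the sign of the odd part of its support function but no mixed
  volume of \<open>K\<close> and the unit ball.\<close>

lemma mixed_Q_odd_eq_0:
  fixes K :: "(real^'n::finite) set"
  assumes K: "convex_body K" and r: "r > 0" and m: "m \<le> CARD('n)" and "odd m"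
    and h: "\<And>u. u \<in> sphere 0 1 \<Longrightarrow> support_function K u = r + h u"
    and odd: "\<And>u. u \<in> sphere 0 1 \<Longrightarrow> h (- u) = - h u"
  shows "mixed_Q m h = 0"
proof -
  let ?B = "cball 0 1 :: (real^'n) set"
  let ?rB = "(\<lambda>x. r *\<^sub>R x) ` ?B"
  let ?K = "uminus ` K"
  note B = convex_body_cball[where 'n = 'n]
  have rB: "convex_body ?rB" using convex_body_scaleR[OF B] r by simp
  have mK: "convex_body ?K" using convex_body_scaleR[OF K, of "-1"] by simp
  have mB: "uminus ` ?B = ?B"
  proof
    show "?B \<subseteq> uminus ` ?B"
    proof
      fix x assume "x \<in> ?B"
      then have "- (- x) \<in> uminus ` ?B" by (intro imageI) simp
      then show "x \<in> uminus ` ?B" by simp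
    qed
  qed auto
  have slots: "mvol (\<lambda>i. if i < k then ?K else if i < m then ?rB else ?B) =
      r ^ (m - k) * mvol (\<lambda>i. if i < k then K else ?B)" if "k \<le> m" for k
  proof -
    have "mvol (\<lambda>i. if i < k then ?K else if i < m then ?rB else ?B) =
        mvol (\<lambda>i. if i \<in> {k..<m} then ?rB else if i < k then ?K else ?B)"
      using that by (intro mvol_cong) auto
    also have "\<dots> = r ^ (m - k) * mvol (\<lambda>i. if i \<in> {k..<m} then ?B else if i < k then ?K else ?B)"
      using that m r by (subst mvol_scaleR_slots) (auto simp: mK B)
    also have "mvol (\<lambda>i. if i \<in> {k..<m} then ?B else if i < k then ?K else ?B) =
        mvol (\<lambda>i. uminus ` (if i < k then K else ?B))"
    proof (rule mvol_cong)
      fix i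
      show "(if i \<in> {k..<m} then ?B else if i < k then ?K else ?B) = uminus ` (if i < k then K else ?B)"
        by (cases "i < k") (simp_all add: mB)
    qed
    also have "\<dots> = mvol (\<lambda>i. if i < k then K else ?B)"
      by (rule mvol_reflect)
    finally show ?thesis .
  qed
  \<comment> \<open>Oddness gives a second representation:
    \<open>h u = - h (- u) = r - support_function K (- u)\<close>, the difference of the support
    functions of \<open>?rB\<close> and \<open>?K\<close>.\<close>
  have "mixed_Q m h = (\<Sum>k\<le>m. real (m choose k) * (-1) ^ k * mvol (\<lambda>i. if i < k then ?K else if i < m then ?rB else ?B))"
  proof (rule mixed_Q_eq_sum[OF rB mK m])
    fix u :: "real^'n" assume u: "u \<in> sphere 0 1"
    then have "- u \<in> sphere 0 1" by simp
    then show "h u = support_function ?rB u - support_function ?K u"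
      using h[of "- u"] odd[OF u] u r
      by (simp add: support_function_uminus support_function_scaleR[OF B] support_function_cball)
  qed
  also have "\<dots> = - mixed_Q m h"
    unfolding mixed_Q_constant_width[OF K r m h, simplified] sum_negf[symmetric]
  proof (intro sum.cong refl)
    fix k assume "k \<in> {..m}"
    then have k: "k \<le> m" by simp
    \<comment> \<open>Here the parity of \<open>m\<close> enters: \<open>k\<close> and
      \<open>m - k\<close> have opposite parities.\<close>
    have "(-1 :: real) ^ k = - ((-1) ^ (m - k))"
      using k \<open>odd m\<close> by (cases "even k") auto
    then show "real (m choose k) * (-1) ^ k * mvol (\<lambda>i. if i < k then ?K else if i < m then ?rB else ?B) =
        - (real (m choose k) * (- r) ^ (m - k) * mvol (\<lambda>i. if i < k then K else ?B))"
      by (simp add: slots[OF k] power_minus[of r])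
  qed
  finally show ?thesis by simp
qed

section \<open>Binomial identities\<close>

lemma binomial_inversion:
  fixes U Q :: "nat \<Rightarrow> real"
  assumes Q: "\<And>m. m \<le> q \<Longrightarrow> Q m = (\<Sum>k\<le>m. real (m choose k) * (- r) ^ (m - k) * U k)"
  shows "U q = (\<Sum>m\<le>q. real (q choose m) * r ^ (q - m) * Q m)"
proof -
  \<comment> \<open>Rewriting the product of binomials as
    \<open>(q choose k) * (q - k choose (m - k))\<close> turns the sum over \<open>m\<close> into
    the expansion of \<open>(- r + r) ^ (q - k)\<close>.\<close>
  have inner: "(\<Sum>m\<le>q. real (q choose m) * real (m choose k) * (r ^ (q - m) * (- r) ^ (m - k))) = (if k = q then 1 else 0)"
    if k: "k \<le> q" for k
  proof -
    have "(\<Sum>m\<le>q. real (q choose m) * real (m choose k) * (r ^ (q - m) * (- r) ^ (m - k))) =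
        (\<Sum>m\<in>{k..q}. real (q choose m) * real (m choose k) * (r ^ (q - m) * (- r) ^ (m - k)))"
      by (rule sum.mono_neutral_right) (auto simp: binomial_eq_0)
    also have "\<dots> = (\<Sum>l\<le>q - k. real (q choose k) * (real (q - k choose l) * (- r) ^ l * r ^ (q - k - l)))"
    proof (rule sum.reindex_bij_witness[of _ "\<lambda>l. k + l" "\<lambda>m. m - k"])
      fix m assume m: "m \<in> {k..q}"
      then have "real (q choose m) * real (m choose k) = real (q choose k) * real (q - k choose (m - k))"
        using choose_mult[of k m q] by (simp flip: of_nat_mult)
      moreover have "q - k - (m - k) = q - m" using m by auto
      ultimately show "real (q choose k) * (real (q - k choose (m - k)) * (- r) ^ (m - k) * r ^ (q - k - (m - k))) =
          real (q choose m) * real (m choose k) * (r ^ (q - m) * (- r) ^ (m - k))"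
        by (simp add: mult_ac)
    qed (use k in auto)
    also have "\<dots> = real (q choose k) * (- r + r) ^ (q - k)"
      unfolding binomial_ring by (simp add: sum_distrib_left)
    finally show ?thesis using k by (auto simp: power_0_left)
  qed
  have "(\<Sum>m\<le>q. real (q choose m) * r ^ (q - m) * Q m) =
      (\<Sum>m\<le>q. \<Sum>k\<le>q. real (q choose m) * real (m choose k) * (r ^ (q - m) * (- r) ^ (m - k)) * U k)"
  proof (rule sum.cong[OF refl])
    fix m assume "m \<in> {..q}"
    then have m: "m \<le> q" by simp
    have "Q m = (\<Sum>k\<le>q. real (m choose k) * (- r) ^ (m - k) * U k)"
      unfolding Q[OF m] using m by (intro sum.mono_neutral_left) (auto simp: binomial_eq_0)
    then show "real (q choose m) * r ^ (q - m) * Q m =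
        (\<Sum>k\<le>q. real (q choose m) * real (m choose k) * (r ^ (q - m) * (- r) ^ (m - k)) * U k)"
      by (simp add: sum_distrib_left mult_ac)
  qed
  also have "\<dots> = (\<Sum>k\<le>q. (\<Sum>m\<le>q. real (q choose m) * real (m choose k) * (r ^ (q - m) * (- r) ^ (m - k))) * U k)"
    by (subst sum.swap) (simp add: sum_distrib_right)
  also have "\<dots> = (\<Sum>k\<le>q. if k = q then U k else 0)"
    by (intro sum.cong refl) (simp add: inner)
  also have "\<dots> = U q" by simp
  finally show ?thesis ..
qed

lemma sum_even_terms:
  fixes g :: "nat \<Rightarrow> real"
  assumes "\<And>m. m \<le> q \<Longrightarrow> odd m \<Longrightarrow> g m = 0"
  shows "(\<Sum>m\<le>q. g m) = (\<Sum>p = 0..q div 2. g (2 * p))"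
proof -
  have "(\<Sum>m\<le>q. g m) = sum g ((*) 2 ` {0..q div 2})"
  proof (rule sum.mono_neutral_right)
    show "\<forall>i\<in>{..q} - (*) 2 ` {0..q div 2}. g i = 0"
    proof
      fix i assume i: "i \<in> {..q} - (*) 2 ` {0..q div 2}"
      have "odd i"
      proof
        assume "even i"
        then have "i = 2 * (i div 2)" by simp
        moreover have "i div 2 \<in> {0..q div 2}" using i by (auto intro: div_le_mono)
        ultimately show False using i by blast
      qed
      then show "g i = 0" using assms i by simp
    qed
  qed auto
  then show ?thesis by (simp add: sum.reindex inj_on_def)
qed

text \<open>Let \<open>T p\<close> be the terms of the volume sum. Absorption,
  \<open>n * (n - 1 choose 2p) = (n - 2p) * (n choose 2p)\<close>, turns the surface sum into
  \<open>T p\<close> weighted by \<open>n - 2p\<close>. Subtracting this from the weight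
  \<open>n - 2\<close> leaves \<open>2 * (p - 1)\<close>, which removes \<open>p = 1\<close> and
  gives \<open>- 2\<close> at \<open>p = 0\<close>.\<close>

lemma weighted_binomial_sum:
  fixes Q :: "nat \<Rightarrow> real" and r :: real
  assumes n: "n \<ge> 3"
  shows "(real n - 2) * (\<Sum>p = 0..n div 2. real (n choose (2 * p)) * r ^ (n - 2 * p) * Q p) =
    r * (real n * (\<Sum>p = 0..(n - 1) div 2. real ((n - 1) choose (2 * p)) * r ^ (n - 1 - 2 * p) * Q p))
    - 2 * Q 0 * r ^ n + 2 * (\<Sum>p = 2..n div 2. (real p - 1) * real (n choose (2 * p)) * r ^ (n - 2 * p) * Q p)"
proof -
  define T where "T p = real (n choose (2 * p)) * r ^ (n - 2 * p) * Q p" for p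
  have "r * (real n * (\<Sum>p = 0..(n - 1) div 2. real ((n - 1) choose (2 * p)) * r ^ (n - 1 - 2 * p) * Q p)) =
      (\<Sum>p = 0..(n - 1) div 2. (real n - 2 * real p) * T p)"
    unfolding sum_distrib_left
  proof (rule sum.cong[OF refl])
    fix p assume "p \<in> {0..(n - 1) div 2}"
    then have p: "2 * p < n" using n by auto
    have 1: "real n * real ((n - 1) choose (2 * p)) = real (n - 2 * p) * real (n choose (2 * p))"
      unfolding of_nat_mult[symmetric] by (simp only: binomial_absorb_comp)
    have 2: "r * r ^ (n - 1 - 2 * p) = r ^ (n - 2 * p)"
      using p by (simp only: power_Suc[symmetric]) (simp add: Suc_diff_Suc)
    have 3: "real (n - 2 * p) = real n - 2 * real p" using p by simp
    have "r * (real n * (real ((n - 1) choose (2 * p)) * r ^ (n - 1 - 2 * p) * Q p)) =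
        (real n * real ((n - 1) choose (2 * p))) * (r * r ^ (n - 1 - 2 * p)) * Q p"
      by (simp only: mult_ac)
    also have "\<dots> = (real n - 2 * real p) * T p"
      by (simp only: 1 2 3 T_def mult.assoc)
    finally show "r * (real n * (real ((n - 1) choose (2 * p)) * r ^ (n - 1 - 2 * p) * Q p)) =
        (real n - 2 * real p) * T p" .
  qed
  \<comment> \<open>The ranges differ only for even \<open>n\<close>, at \<open>p = n div 2\<close>,
    where the weight is zero.\<close>
  also have "\<dots> = (\<Sum>p = 0..n div 2. (real n - 2 * real p) * T p)"
  proof (rule sum.mono_neutral_left)
    show "\<forall>p\<in>{0..n div 2} - {0..(n - 1) div 2}. (real n - 2 * real p) * T p = 0"
    proof
      fix p assume "p \<in> {0..n div 2} - {0..(n - 1) div 2}"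
      then have "n = 2 * p" by auto
      then show "(real n - 2 * real p) * T p = 0" by simp
    qed
  qed auto
  finally have S: "r * (real n * (\<Sum>p = 0..(n - 1) div 2. real ((n - 1) choose (2 * p)) * r ^ (n - 1 - 2 * p) * Q p)) =
      (\<Sum>p = 0..n div 2. (real n - 2 * real p) * T p)" .
  have "(real n - 2) * (\<Sum>p = 0..n div 2. T p) - (\<Sum>p = 0..n div 2. (real n - 2 * real p) * T p) =
      (\<Sum>p = 0..n div 2. 2 * (real p - 1) * T p)"
    unfolding sum_distrib_left sum_subtractf[symmetric]
    by (intro sum.cong refl) (simp add: algebra_simps)
  also have "\<dots> = - 2 * T 0 + (\<Sum>p = 2..n div 2. 2 * (real p - 1) * T p)"
  proof -
    have "{0..n div 2} = insert 0 (insert 1 {2..n div 2})" using n by auto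
    then show ?thesis by simp
  qed
  also have "(\<Sum>p = 2..n div 2. 2 * (real p - 1) * T p) =
      2 * (\<Sum>p = 2..n div 2. (real p - 1) * real (n choose (2 * p)) * r ^ (n - 2 * p) * Q p)"
    unfolding sum_distrib_left T_def by (simp only: mult.assoc)
  also have "- 2 * T 0 + 2 * (\<Sum>p = 2..n div 2. (real p - 1) * real (n choose (2 * p)) * r ^ (n - 2 * p) * Q p) =
      - 2 * Q 0 * r ^ n + 2 * (\<Sum>p = 2..n div 2. (real p - 1) * real (n choose (2 * p)) * r ^ (n - 2 * p) * Q p)"
    by (simp add: T_def)
  finally show ?thesis unfolding S unfolding T_def by linarith
qed

theorem theorem10p1:
  fixes K :: "(real ^ 'n::finite) set" and r :: real and h_odd :: "real ^ 'n \<Rightarrow> real"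
  assumes "convex_body K"
    and "r > 0"
    and "constant_width K (2 * r)"
    and "\<forall>u\<in>sphere 0 1. support_function K u = r + h_odd u"
    and "\<forall>u\<in>sphere 0 1. h_odd (- u) = - h_odd u"
  shows "mixed_Q 0 h_odd = measure lebesgue (cball (0 :: real ^ 'n) 1) \<and>
         (\<forall>j\<le>CARD('n). quermassintegral j K =
           (\<Sum>p = 0..(CARD('n) - j) div 2.
              real ((CARD('n) - j) choose (2 * p)) * r ^ (CARD('n) - j - 2 * p) * mixed_Q (2 * p) h_odd)) \<and>
         (CARD('n) \<ge> 3 \<longrightarrow>
           measure lebesgue K =
             r / (real CARD('n) - 2) * surface_area K
             - 2 * measure lebesgue (cball (0 :: real ^ 'n) 1) / (real CARD('n) - 2) * r ^ CARD('n)
             + 2 / (real CARD('n) - 2) *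
               (\<Sum>p = 2..CARD('n) div 2.
                  (real p - 1) * real (CARD('n) choose (2 * p)) * r ^ (CARD('n) - 2 * p) * mixed_Q (2 * p) h_odd))"
proof -
  let ?n = "CARD('n)"
  let ?B = "cball 0 1 :: (real^'n) set"
  let ?U = "\<lambda>q. mvol (\<lambda>i. if i < q then K else ?B)"
  have h: "\<And>u. u \<in> sphere 0 1 \<Longrightarrow> support_function K u = r + h_odd u"
    and odd: "\<And>u. u \<in> sphere 0 1 \<Longrightarrow> h_odd (- u) = - h_odd u"
    using assms(4,5) by auto
  note Q = mixed_Q_constant_width[OF assms(1,2) _ h]
  \<comment> \<open>For \<open>m = 0\<close> the only term is \<open>k = 0\<close>, with the ball in
    every slot.\<close>
  have Q0: "mixed_Q 0 h_odd = measure lebesgue ?B"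
    using Q[of 0] mvol_const[of ?B] convex_body_cball[where 'n = 'n] by simp
  have W: "quermassintegral j K = (\<Sum>p = 0..(?n - j) div 2.
      real ((?n - j) choose (2 * p)) * r ^ (?n - j - 2 * p) * mixed_Q (2 * p) h_odd)" if j: "j \<le> ?n" for j
  proof -
    have "quermassintegral j K = ?U (?n - j)"
      by (rule quermassintegral_eq_mvol[OF assms(1) j])
    also have "\<dots> = (\<Sum>m\<le>?n - j. real ((?n - j) choose m) * r ^ (?n - j - m) * mixed_Q m h_odd)"
      by (rule binomial_inversion[where U = ?U]) (use Q in auto)
    also have "\<dots> = (\<Sum>p = 0..(?n - j) div 2.
      real ((?n - j) choose (2 * p)) * r ^ (?n - j - 2 * p) * mixed_Q (2 * p) h_odd)"
      by (rule sum_even_terms) (use mixed_Q_odd_eq_0[OF assms(1,2) _ _ h odd] in auto)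
    finally show ?thesis .
  qed
  have "measure lebesgue K =
             r / (real ?n - 2) * surface_area K
             - 2 * measure lebesgue ?B / (real ?n - 2) * r ^ ?n
             + 2 / (real ?n - 2) *
               (\<Sum>p = 2..?n div 2.
                  (real p - 1) * real (?n choose (2 * p)) * r ^ (?n - 2 * p) * mixed_Q (2 * p) h_odd)"
    if n: "?n \<ge> 3"
  proof -
    have "measure lebesgue K = quermassintegral 0 K"
      using mvol_const[of K] assms(1) by (simp add: quermassintegral_eq_mvol cong: mvol_cong)
    \<comment> \<open>Weighting the volume by \<open>n - 2\<close> cancels
      \<open>mixed_Q 2 h_odd\<close> against its contribution to the surface area.\<close>
    then have "(real ?n - 2) * measure lebesgue K = r * surface_area K - 2 * mixed_Q 0 h_odd * r ^ ?n
        + 2 * (\<Sum>p = 2..?n div 2. (real p - 1) * real (?n choose (2 * p)) * r ^ (?n - 2 * p) * mixed_Q (2 * p) h_odd)"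
      using weighted_binomial_sum[OF n, of r "\<lambda>p. mixed_Q (2 * p) h_odd"] W[of 0] W[of 1] n
      by (simp add: surface_area_def)
    then have "measure lebesgue K = (r * surface_area K - 2 * measure lebesgue ?B * r ^ ?n
        + 2 * (\<Sum>p = 2..?n div 2. (real p - 1) * real (?n choose (2 * p)) * r ^ (?n - 2 * p) * mixed_Q (2 * p) h_odd))
        / (real ?n - 2)"
      using n unfolding Q0 by (simp add: eq_divide_eq mult.commute)
    then show ?thesis by (simp add: add_divide_distrib diff_divide_distrib)
  qed
  with Q0 W show ?thesis by blast
qed

end
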